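(* Fix $i\in\{1,\dots,n\}$. For any two positive integers $m$ and $k$, $m\le k\le c$, there exist scalars $c_{l,j},d_{l,j}\in\mathbb{C}(q)$, where $j=0,1,\dots,l$, $l=0,1,\dots,m-1$, such that the following equalities hold for every $l=0,1,\dots,m-1$: $$\bar{x}^+_{m\alpha_i}(z)_{-l-1}\,\bar{x}^+_{k\alpha_i}(z\mathsf q)=z^{-l}\sum_{j=0}^{l}c_{l,j}\,\bar{x}^+_{(m-1-j)\alpha_i}(z\mathsf q^{l+1})\,\bar{x}^+_{(k+1+j)\alpha_i}(z\mathsf q^{l-j})\in\langle\mathcal{S}_i\rangle,$$ $$\bar{x}^+_{m\alpha_i}(z\mathsf q^k)_{-l-1}\,\bar{x}^+_{k\alpha_i}(z)=z^{-l}\sum_{j=0}^{l}d_{l,j}\,\bar{x}^+_{j\alpha_i}(z\mathsf q^{k+l-j})\,\bar{x}^+_{(m+k-j)\alpha_i}(z\mathsf q^{l})\in\langle\mathcal{S}_i\rangle,$$ where $\bar{x}^+_{0\alpha_i}(z)=1$. Furthermore, using only these $2m$ equalities (that is, only the linear relations obtained by applying them to a vector and comparing coefficients of powers of $z$), one can, for every $v\in L$ and all $r,N\in\mathbb{Z}$, express the $2m$ vectors $$\bar{x}^+_{m\alpha_i}(r+l)\,\bar{x}^+_{k\alpha_i}(N-(r+l))v,\qquad l=0,1,\dots,2m-1,$$ as linear combinations of the vectors $\bar{x}^+_{m\alpha_i}(s)\,\bar{x}^+_{k\alpha_i}(N-s)v$ with $s\in\mathbb{Z}\setminus\{r,r+1,\dots,r+2m-1\}$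 and the vectors $\bar{x}^+_{m'\alpha_i}(t)\,\bar{x}^+_{k'\alpha_i}(N-t)v$ with $0\le m'<m$, $m+k=m'+k'$, $t\in\mathbb{Z}$.
   Context: Let $q$ be an indeterminate, $\mathsf q=q^2$, and let $L$ be an integrable highest weight module of level $c\in\mathbb{Z}_{>0}$ for $U_q(\widehat{\mathfrak{sl}}_{n+1})$ over $\mathbb{C}(q^{1/2})$. $\mathcal{E}(L)=\mathrm{Hom}(L,L((z)))$. In the Drinfeld realization, with generators $x_i^{\pm}(r)$, $a_i(s)$ ($i=1,\dots,n$, $r,s\in\mathbb{Z}$, $s\ne0$) and $x_i^+(z)=\sum_rx_i^+(r)z^{-r-1}$, one has $[a_i(s),x_i^+(l)]=\frac{[2s]}{s}q^{-c|s|/2}x_i^+(s+l)$ on $L$, with $[m]=\frac{q^m-q^{-m}}{q-q^{-1}}$. The Ding–Feigin operators are $$\bar{x}^+_{\alpha_i}(z)=x_i^+(z)\exp\Big(-(q-q^{-1})\sum_{r\ge1}\tfrac{q^{(2+c/2)r}}{1+q^{2r}}a_i(r)z^{-r}\Big)\in\mathcal{E}(L).$$ They satisfy $[\bar{x}^+_{\alpha_i}(z_1),\bar{x}^+_{\alpha_i}(z_2)]=0$ and $\bar{x}^+_{\alpha_i}(z)\bar{x}^+_{\alpha_i}(zq^2)\cdots\bar{x}^+_{\alpha_i}(zq^{2m})=0$ for $m\ge c$. For $m\ge1$ set $$\bar{x}^+_{m\alpha_i}(z)=\bar{x}^+_{\alpha_i}(z)\bar{x}^+_{\alpha_i}(zq^2)\cdots\bar{x}^+_{\alpha_i}(zq^{2(m-1)})=\sum_{r\in\mathbb{Z}}\bar{x}^+_{m\alpha_i}(r)z^{-r-m}\in\mathcal{E}(L).$$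 Products: $[m]_{\mathsf q}=\frac{\mathsf q^m-1}{\mathsf q-1}$, $[l]_{\mathsf q}!=[l]_{\mathsf q}\cdots[1]_{\mathsf q}$; $a^{[1]}(z)=\frac{a(z\mathsf q)-a(z)}{z(\mathsf q-1)}$ and $a^{[n]}$ is the $n$-th iterate. For $a(z),b(z)\in\mathcal{E}(L)$ with $a(z_1)b(z_2)\in\mathrm{Hom}(L,L((z_1,z_2)))$ set $a(z)_rb(z)=0$ for $r\ge0$ and $a(z)_rb(z)=\frac{1}{[-r-1]_{\mathsf q}!}a^{[-r-1]}(z)\,b(z\mathsf q^{-r-1})$ for $r<0$. In the claim, $\bar{x}^+_{m\alpha_i}(z\mathsf q^k)_{-l-1}$ is the product with $a(z)=\bar{x}^+_{m\alpha_i}(z\mathsf q^k)$ regarded as a series in $z$, and $\bar{x}^+_{k\alpha_i}(z\mathsf q)$ is likewise regarded as a series $b(z)$. $\mathcal{S}_i=\{\bar{x}^+_{\alpha_i}(z\mathsf q^l)\mid l\in\mathbb{Z}_{\ge0}\}$, and $\langle\mathcal{S}_i\rangle\subset\mathcal{E}(L)$ is the nonlocal $\mathsf q$-vertex algebra generated by $\mathcal{S}_i$, i.e. the smallest subspace of $\mathcal{E}(L)$ containing $\mathcal{S}_i$ and the identity $1_L$ and closed under all the products $a(z)_rb(z)$. *)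

theory Defs
  imports
    Complex_Main
    "HOL-Library.Groups_Big_Fun"
    "HOL-Computational_Algebra.Polynomial"
    "HOL-Computational_Algebra.Fraction_Field"
begin

section \<open>The ground field\<close>

text \<open>The field \<open>\<complex>(q\<^bsup>1/2\<^esup>)\<close> is the fraction field of the polynomials in the indeterminate
  \<open>q\<^bsup>1/2\<^esup>\<close>.\<close>

type_synonym qfield = "complex poly fract"

definition qh :: qfield where \<comment> \<open>\<open>q\<^bsup>1/2\<^esup>\<close>\<close>
  "qh = Fract [:0, 1:] 1"

definition q :: qfield where
  "q = qh ^ 2"

definition qq :: qfield where \<comment> \<open>the sans-serif \<open>q\<close>, i.e. \<open>q\<^sup>2\<close>\<close>
  "qq = q ^ 2"

definition Cq :: "qfield set" where \<comment> \<open>the subfield \<open>\<complex>(q)\<close>: rational functions of \<open>(q\<^bsup>1/2\<^esup>)\<^sup>2\<close>\<close>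
  "Cq = {Fract (pcompose f [:0, 0, 1:]) (pcompose g [:0, 0, 1:]) | f g. g \<noteq> 0}"

definition qint :: "int \<Rightarrow> qfield" where
  "qint m = (q powi m - q powi (- m)) / (q - inverse q)"

definition qfact :: "nat \<Rightarrow> qfield" where
  "qfact m = (\<Prod>i = 1..m. qint (int i))"

definition qbinom :: "nat \<Rightarrow> nat \<Rightarrow> qfield" where
  "qbinom m r = qfact m / (qfact r * qfact (m - r))"

definition qqint :: "nat \<Rightarrow> qfield" where
  "qqint m = (qq ^ m - 1) / (qq - 1)"

definition qqfact :: "nat \<Rightarrow> qfield" where
  "qqfact m = (\<Prod>i = 1..m. qqint i)"


section \<open>Operator-valued series\<close>

text \<open>A series \<open>a(z) = \<Sum>\<^sub>n a\<^sub>n z\<^sup>n\<close> with operator coefficients is the function mapping \<open>n\<close> to \<open>a\<^sub>n\<close>,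
  the coefficient of \<open>z\<^sup>n\<close>.  Infinite sums that are finite on every vector are written with
  \<^const>\<open>Sum_any\<close>, the sum over the support.\<close>

type_synonym 'v ser = "int \<Rightarrow> 'v \<Rightarrow> 'v"

definition Eser :: "(qfield \<Rightarrow> 'v::ab_group_add \<Rightarrow> 'v) \<Rightarrow> 'v ser set" where \<comment> \<open>\<open>Hom(L, L((z)))\<close>\<close>
  "Eser scale = {a. (\<forall>n. Vector_Spaces.linear scale scale (a n)) \<and>
                    (\<forall>v. \<exists>n0. \<forall>n < n0. a n v = 0)}"

definition compatible :: "'v::ab_group_add ser \<Rightarrow> 'v ser \<Rightarrow> bool" where
  \<comment> \<open>\<open>a(z\<^sub>1)b(z\<^sub>2)\<close> maps \<open>L\<close> into \<open>L((z\<^sub>1,z\<^sub>2))\<close>, the series with exponents bounded below in both variables\<close>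
  "compatible a b \<longleftrightarrow> (\<forall>v. \<exists>n0. \<forall>s t. s < n0 \<or> t < n0 \<longrightarrow> a s (b t v) = 0)"

definition ser_one :: "'v::ab_group_add ser" where
  "ser_one n v = (if n = 0 then v else 0)"

definition ser_mult :: "'v::ab_group_add ser \<Rightarrow> 'v ser \<Rightarrow> 'v ser" where \<comment> \<open>\<open>a(z)b(z)\<close>\<close>
  "ser_mult a b n v = Sum_any (\<lambda>s. a s (b (n - s) v))"

definition ser_scale :: "(qfield \<Rightarrow> 'v \<Rightarrow> 'v) \<Rightarrow> qfield \<Rightarrow> 'v ser \<Rightarrow> 'v ser" where
  "ser_scale scale \<kappa> a n v = scale \<kappa> (a n v)"

definition dil :: "(qfield \<Rightarrow> 'v \<Rightarrow> 'v) \<Rightarrow> nat \<Rightarrow> 'v ser \<Rightarrow> 'v ser" where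
  \<comment> \<open>\<open>a(zp\<^sup>l)\<close> for \<open>p = q\<^sup>2\<close>\<close>
  "dil scale l a n v = scale ((qq ^ l) powi n) (a n v)"

definition zshift :: "nat \<Rightarrow> 'v ser \<Rightarrow> 'v ser" where \<comment> \<open>\<open>z\<^bsup>-l\<^esup>a(z)\<close>\<close>
  "zshift l a n v = a (n + int l) v"

definition qderiv :: "(qfield \<Rightarrow> 'v::ab_group_add \<Rightarrow> 'v) \<Rightarrow> 'v ser \<Rightarrow> 'v ser" where
  "qderiv scale a = zshift 1 (\<lambda>n v. scale (1 / (qq - 1)) (dil scale 1 a n v - a n v))"

definition qprod :: "(qfield \<Rightarrow> 'v::ab_group_add \<Rightarrow> 'v) \<Rightarrow> 'v ser \<Rightarrow> int \<Rightarrow> 'v ser \<Rightarrow> 'v ser" where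
  "qprod scale a r b =
     (if r \<ge> 0 then (\<lambda>n v. 0)
      else let p = nat (- r - 1)
           in ser_scale scale (1 / qqfact p) (ser_mult ((qderiv scale ^^ p) a) (dil scale p b)))"

text \<open>The nonlocal \<open>q\<^sup>2\<close>-vertex algebra generated by \<open>S \<subseteq> Hom(L, L((z)))\<close>: the smallest subspace
  containing \<open>S\<close> and the identity that is closed under all (defined) products.\<close>

inductive_set qva_generated ::
    "(qfield \<Rightarrow> 'v::ab_group_add \<Rightarrow> 'v) \<Rightarrow> 'v ser set \<Rightarrow> 'v ser set"
  for scale and S where
  base: "a \<in> S \<Longrightarrow> a \<in> Eser scale \<Longrightarrow> a \<in> qva_generated scale S"
| one: "ser_one \<in> qva_generated scale S"
| zero: "(\<lambda>n v. 0) \<in> qva_generated scale S"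
| add: "a \<in> qva_generated scale S \<Longrightarrow> b \<in> qva_generated scale S \<Longrightarrow>
        (\<lambda>n v. a n v + b n v) \<in> qva_generated scale S"
| scal: "a \<in> qva_generated scale S \<Longrightarrow> ser_scale scale \<kappa> a \<in> qva_generated scale S"
| prod: "a \<in> qva_generated scale S \<Longrightarrow> b \<in> qva_generated scale S \<Longrightarrow> compatible a b \<Longrightarrow>
         qprod scale a r b \<in> qva_generated scale S"

text \<open>\<open>exp_coeff scale A N\<close> is the coefficient of \<open>w\<^sup>N\<close> in \<open>exp(\<Sum>\<^bsub>r\<ge>1\<^esub> A\<^sub>r w\<^sup>r)\<close>, and
  \<open>pow_coeff A p N\<close> the one in \<open>(\<Sum>\<^bsub>r\<ge>1\<^esub> A\<^sub>r w\<^sup>r)\<^sup>p\<close>.\<close>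

primrec pow_coeff :: "(nat \<Rightarrow> 'v::ab_group_add \<Rightarrow> 'v) \<Rightarrow> nat \<Rightarrow> nat \<Rightarrow> 'v \<Rightarrow> 'v" where
  "pow_coeff A 0 = (\<lambda>N v. if N = 0 then v else 0)"
| "pow_coeff A (Suc p) = (\<lambda>N v. \<Sum>r = 1..N. A r (pow_coeff A p (N - r) v))"

definition exp_coeff ::
    "(qfield \<Rightarrow> 'v::ab_group_add \<Rightarrow> 'v) \<Rightarrow> (nat \<Rightarrow> 'v \<Rightarrow> 'v) \<Rightarrow> nat \<Rightarrow> 'v \<Rightarrow> 'v" where
  "exp_coeff scale A N v = (\<Sum>p\<le>N. scale (1 / of_nat (fact p)) (pow_coeff A p N v))"


section \<open>Modules for the quantum affine algebra\<close>

text \<open>The generalized Cartan matrix of type \<open>A\<^sub>n\<^sup>(\<^sup>1\<^sup>)\<close> on the nodes \<open>0..n\<close>; the off-diagonal entries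
  are \<open>-2\<close> for \<open>n = 1\<close>, where both neighbour conditions hold.\<close>

definition cartan :: "nat \<Rightarrow> nat \<Rightarrow> nat \<Rightarrow> int" where
  "cartan n i j = (if i = j then 2 else 0)
     - (if (i + 1) mod (n + 1) = j then 1 else 0) - (if (j + 1) mod (n + 1) = i then 1 else 0)"

definition qcomm :: "(qfield \<Rightarrow> 'v::ab_group_add \<Rightarrow> 'v) \<Rightarrow> qfield \<Rightarrow>
    ('v \<Rightarrow> 'v) \<Rightarrow> ('v \<Rightarrow> 'v) \<Rightarrow> 'v \<Rightarrow> 'v" where \<comment> \<open>\<open>[A,B]\<^sub>u = AB - uBA\<close>\<close>
  "qcomm scale u A B v = A (B v) - scale u (B (A v))"

primrec nested_qcomm :: "(qfield \<Rightarrow> 'v::ab_group_add \<Rightarrow> 'v) \<Rightarrow>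
    (nat \<Rightarrow> 'v \<Rightarrow> 'v) \<Rightarrow> ('v \<Rightarrow> 'v) \<Rightarrow> nat \<Rightarrow> 'v \<Rightarrow> 'v" where
  \<comment> \<open>\<open>[X\<^bsub>p+1\<^esub>, [X\<^sub>p, \<dots>, [X\<^sub>2, Y]\<dots>]]\<close> with every bracket a \<open>q\<^bsup>-1\<^esup>\<close>-commutator\<close>
  "nested_qcomm scale X Y 0 = Y"
| "nested_qcomm scale X Y (Suc p) = qcomm scale (inverse q) (X (p + 2)) (nested_qcomm scale X Y p)"

text \<open>For one index \<open>i\<close>, with \<open>Ki\<close> and \<open>A s\<close> the actions of \<open>K\<^sub>i\<close> and \<open>a\<^sub>i(s)\<close>:
  \<open>\<Sum>\<^bsub>r\<ge>0\<^esub> \<psi>\<^sub>i(r)z\<^bsup>-r\<^esup> = K\<^sub>i exp((q-q\<^bsup>-1\<^esup>)\<Sum>\<^bsub>s\<ge>1\<^esub> a\<^sub>i(s)z\<^bsup>-s\<^esup>)\<close> and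
  \<open>\<Sum>\<^bsub>r\<ge>0\<^esub> \<phi>\<^sub>i(-r)z\<^sup>r = K\<^sub>i\<^bsup>-1\<^esup> exp(-(q-q\<^bsup>-1\<^esup>)\<Sum>\<^bsub>s\<ge>1\<^esub> a\<^sub>i(-s)z\<^sup>s)\<close>.\<close>

definition psi :: "(qfield \<Rightarrow> 'v::ab_group_add \<Rightarrow> 'v) \<Rightarrow> ('v \<Rightarrow> 'v) \<Rightarrow> (int \<Rightarrow> 'v \<Rightarrow> 'v) \<Rightarrow> int \<Rightarrow> 'v \<Rightarrow> 'v" where
  "psi scale Ki A r v = (if r < 0 then 0
     else Ki (exp_coeff scale (\<lambda>s w. scale (q - inverse q) (A (int s) w)) (nat r) v))"

definition phi :: "(qfield \<Rightarrow> 'v::ab_group_add \<Rightarrow> 'v) \<Rightarrow> ('v \<Rightarrow> 'v) \<Rightarrow> (int \<Rightarrow> 'v \<Rightarrow> 'v) \<Rightarrow> int \<Rightarrow> 'v \<Rightarrow> 'v" where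
  "phi scale Ki A r v = (if r > 0 then 0
     else inv Ki (exp_coeff scale (\<lambda>s w. scale (- (q - inverse q)) (A (- int s) w)) (nat (- r)) v))"

text \<open>A module for \<open>U\<^sub>q\<close> of affine \<open>sl\<^bsub>n+1\<^esub>\<close> on which the central element \<open>\<gamma>\<^bsup>1/2\<^esup>\<close> acts as
  \<open>q\<^bsup>c/2\<^esup>\<close> (level \<open>c\<close>).  A module is given by the operators of the generators: \<open>e i\<close>, \<open>f i\<close>, \<open>K i\<close>
  (\<open>0 \<le> i \<le> n\<close>) and \<open>qd\<close> (the action of \<open>q\<^sup>d\<close>) are the Chevalley generators; \<open>xp i r\<close>, \<open>xm i r\<close>
  and \<open>a i s\<close> (\<open>1 \<le> i \<le> n\<close>, \<open>s \<noteq> 0\<close>) are the Drinfeld generators.  The two presentations are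
  identified by Drinfeld's isomorphism, which is \<open>e_eq\<close>, \<open>f_eq\<close>, \<open>K_central\<close>, \<open>e0_eq\<close>, \<open>f0_eq\<close> (with
  \<open>K\<^sub>0 = \<gamma>(K\<^sub>1\<cdots>K\<^sub>n)\<^bsup>-1\<^esup>\<close>).\<close>

locale uq_affine_module =
  vector_space scale for scale :: "qfield \<Rightarrow> 'v::ab_group_add \<Rightarrow> 'v" +
  fixes n :: nat and c :: nat
    and e f K :: "nat \<Rightarrow> 'v \<Rightarrow> 'v" and qd :: "'v \<Rightarrow> 'v"
    and xp xm a :: "nat \<Rightarrow> int \<Rightarrow> 'v \<Rightarrow> 'v"
  assumes rank_pos: "n \<ge> 1"
    and lin_chevalley: "i \<le> n \<Longrightarrow> Vector_Spaces.linear scale scale (e i) \<and>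
          Vector_Spaces.linear scale scale (f i) \<and>
          Vector_Spaces.linear scale scale (K i) \<and> bij (K i)"
    and lin_qd: "Vector_Spaces.linear scale scale qd \<and> bij qd"
    and lin_drinfeld: "i \<in> {1..n} \<Longrightarrow> Vector_Spaces.linear scale scale (xp i r) \<and>
          Vector_Spaces.linear scale scale (xm i r)"
    and lin_a: "i \<in> {1..n} \<Longrightarrow> s \<noteq> 0 \<Longrightarrow> Vector_Spaces.linear scale scale (a i s)"
    and K_K: "i \<le> n \<Longrightarrow> j \<le> n \<Longrightarrow> K i (K j v) = K j (K i v)"
    and qd_K: "i \<le> n \<Longrightarrow> qd (K i v) = K i (qd v)"
    and qd_e: "i \<le> n \<Longrightarrow> qd (e i v) = scale (if i = 0 then q else 1) (e i (qd v))"
    and qd_f: "i \<le> n \<Longrightarrow> qd (f i v) = scale (if i = 0 then inverse q else 1) (f i (qd v))"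
    and K_e: "i \<le> n \<Longrightarrow> j \<le> n \<Longrightarrow> K i (e j v) = scale (q powi cartan n i j) (e j (K i v))"
    and K_f: "i \<le> n \<Longrightarrow> j \<le> n \<Longrightarrow> K i (f j v) = scale (q powi (- cartan n i j)) (f j (K i v))"
    and e_f: "i \<le> n \<Longrightarrow> j \<le> n \<Longrightarrow> e i (f j v) - f j (e i v) =
          (if i = j then scale (1 / (q - inverse q)) (K i v - inv (K i) v) else 0)"
    and serre_e: "i \<le> n \<Longrightarrow> j \<le> n \<Longrightarrow> i \<noteq> j \<Longrightarrow> M = nat (1 - cartan n i j) \<Longrightarrow>
          (\<Sum>r\<le>M. scale ((- 1) ^ r * qbinom M r) ((e i ^^ (M - r)) (e j ((e i ^^ r) v)))) = 0"
    and serre_f: "i \<le> n \<Longrightarrow> j \<le> n \<Longrightarrow> i \<noteq> j \<Longrightarrow> M = nat (1 - cartan n i j) \<Longrightarrow>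
          (\<Sum>r\<le>M. scale ((- 1) ^ r * qbinom M r) ((f i ^^ (M - r)) (f j ((f i ^^ r) v)))) = 0"
    \<comment> \<open>in the Drinfeld relations \<open>\<gamma>\<^bsup>k/2\<^esup>\<close> acts as \<open>qh powi (c * k)\<close>\<close>
    and K_a: "i \<le> n \<Longrightarrow> j \<in> {1..n} \<Longrightarrow> s \<noteq> 0 \<Longrightarrow> K i (a j s v) = a j s (K i v)"
    and qd_a: "i \<in> {1..n} \<Longrightarrow> s \<noteq> 0 \<Longrightarrow> qd (a i s v) = scale (q powi s) (a i s (qd v))"
    and qd_xp: "i \<in> {1..n} \<Longrightarrow> qd (xp i r v) = scale (q powi r) (xp i r (qd v))"
    and qd_xm: "i \<in> {1..n} \<Longrightarrow> qd (xm i r v) = scale (q powi r) (xm i r (qd v))"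
    and K_xp: "i \<in> {1..n} \<Longrightarrow> j \<in> {1..n} \<Longrightarrow>
          K i (xp j r v) = scale (q powi cartan n i j) (xp j r (K i v))"
    and K_xm: "i \<in> {1..n} \<Longrightarrow> j \<in> {1..n} \<Longrightarrow>
          K i (xm j r v) = scale (q powi (- cartan n i j)) (xm j r (K i v))"
    and a_a: "i \<in> {1..n} \<Longrightarrow> j \<in> {1..n} \<Longrightarrow> s \<noteq> 0 \<Longrightarrow> t \<noteq> 0 \<Longrightarrow>
          a i s (a j t v) - a j t (a i s v) =
          (if s + t = 0
           then scale (qint (cartan n i j * s) / of_int s *
                  ((q powi (int c * s) - q powi (- (int c * s))) / (q - inverse q))) v
           else 0)"
    and a_xp: "i \<in> {1..n} \<Longrightarrow> j \<in> {1..n} \<Longrightarrow> s \<noteq> 0 \<Longrightarrow>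
          a i s (xp j r v) - xp j r (a i s v) =
          scale (qint (cartan n i j * s) / of_int s * qh powi (- (int c * \<bar>s\<bar>))) (xp j (s + r) v)"
    and a_xm: "i \<in> {1..n} \<Longrightarrow> j \<in> {1..n} \<Longrightarrow> s \<noteq> 0 \<Longrightarrow>
          a i s (xm j r v) - xm j r (a i s v) =
          scale (- (qint (cartan n i j * s) / of_int s * qh powi (int c * \<bar>s\<bar>))) (xm j (s + r) v)"
    and xp_xp: "i \<in> {1..n} \<Longrightarrow> j \<in> {1..n} \<Longrightarrow>
          xp i (r + 1) (xp j s v) - scale (q powi cartan n i j) (xp j s (xp i (r + 1) v)) =
          scale (q powi cartan n i j) (xp i r (xp j (s + 1) v)) - xp j (s + 1) (xp i r v)"
    and xm_xm: "i \<in> {1..n} \<Longrightarrow> j \<in> {1..n} \<Longrightarrow>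
          xm i (r + 1) (xm j s v) - scale (q powi (- cartan n i j)) (xm j s (xm i (r + 1) v)) =
          scale (q powi (- cartan n i j)) (xm i r (xm j (s + 1) v)) - xm j (s + 1) (xm i r v)"
    and xp_xm: "i \<in> {1..n} \<Longrightarrow> j \<in> {1..n} \<Longrightarrow>
          xp i r (xm j s v) - xm j s (xp i r v) =
          (if i = j
           then scale (1 / (q - inverse q))
                  (scale (qh powi (int c * (r - s))) (psi scale (K i) (a i) (r + s) v)
                   - scale (qh powi (int c * (s - r))) (phi scale (K i) (a i) (r + s) v))
           else 0)"
    and xp_far: "i \<in> {1..n} \<Longrightarrow> j \<in> {1..n} \<Longrightarrow> cartan n i j = 0 \<Longrightarrow>
          xp i r (xp j s v) = xp j s (xp i r v)"
    and xm_far: "i \<in> {1..n} \<Longrightarrow> j \<in> {1..n} \<Longrightarrow> cartan n i j = 0 \<Longrightarrow>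
          xm i r (xm j s v) = xm j s (xm i r v)"
    and serre_xp: "i \<in> {1..n} \<Longrightarrow> j \<in> {1..n} \<Longrightarrow> cartan n i j = -1 \<Longrightarrow>
          (\<Sum>(r, s) \<leftarrow> [(r1, r2), (r2, r1)].
             xp i r (xp i s (xp j t v)) - scale (qint 2) (xp i r (xp j t (xp i s v)))
             + xp j t (xp i r (xp i s v))) = 0"
    and serre_xm: "i \<in> {1..n} \<Longrightarrow> j \<in> {1..n} \<Longrightarrow> cartan n i j = -1 \<Longrightarrow>
          (\<Sum>(r, s) \<leftarrow> [(r1, r2), (r2, r1)].
             xm i r (xm i s (xm j t v)) - scale (qint 2) (xm i r (xm j t (xm i s v)))
             + xm j t (xm i r (xm i s v))) = 0"
    and e_eq: "i \<in> {1..n} \<Longrightarrow> e i = xp i 0"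
    and f_eq: "i \<in> {1..n} \<Longrightarrow> f i = xm i 0"
    and K_central: "foldr K [0..<n + 1] v = scale (q ^ c) v"
    and e0_eq: "e 0 = (\<lambda>v. nested_qcomm scale (\<lambda>j. xm j 0) (xm 1 1) (n - 1) (K 0 v))"
    and f0_eq: "f 0 = (\<lambda>v. scale ((- q) ^ (n - 1))
                  (inv (K 0) (nested_qcomm scale (\<lambda>j. xp j 0) (xp 1 (- 1)) (n - 1) v)))"

text \<open>Highest weight: \<open>\<Lambda> i\<close> is the value of the highest weight on the \<open>i\<close>-th simple coroot, \<open>b\<close> its
  value on \<open>d\<close>.  The module is generated by the highest weight vector \<open>v0\<close>, and integrability is
  local nilpotency of all \<open>e i\<close> and \<open>f i\<close>.\<close>

locale integrable_highest_weight_module = uq_affine_module +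
  assumes highest_weight: "\<exists>v0 (\<Lambda> :: nat \<Rightarrow> int) (b :: int). v0 \<noteq> 0 \<and>
          (\<forall>i\<le>n. e i v0 = 0 \<and> K i v0 = scale (q powi \<Lambda> i) v0) \<and> qd v0 = scale (q powi b) v0 \<and>
          (\<forall>W. module.subspace scale W \<and> v0 \<in> W \<and>
               (\<forall>i\<le>n. \<forall>w\<in>W. e i w \<in> W \<and> f i w \<in> W \<and> K i w \<in> W \<and> inv (K i) w \<in> W) \<and>
               (\<forall>w\<in>W. qd w \<in> W \<and> inv qd w \<in> W) \<longrightarrow> W = UNIV)"
    and integrable: "i \<le> n \<Longrightarrow> (\<exists>p. (e i ^^ p) v = 0) \<and> (\<exists>p. (f i ^^ p) v = 0)"


section \<open>The Ding--Feigin operators\<close>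

text \<open>The arguments are the level \<open>c\<close> and, for a fixed index \<open>i\<close>, the operators \<open>X r = x\<^sub>i\<^sup>+(r)\<close> and
  \<open>A s = a\<^sub>i(s)\<close>.  Note \<open>q\<^bsup>(2+c/2)r\<^esup> = qh ^ ((4 + c) * r)\<close>.\<close>

definition xbar1 :: "(qfield \<Rightarrow> 'v::ab_group_add \<Rightarrow> 'v) \<Rightarrow> nat \<Rightarrow>
    (int \<Rightarrow> 'v \<Rightarrow> 'v) \<Rightarrow> (int \<Rightarrow> 'v \<Rightarrow> 'v) \<Rightarrow> 'v ser" where
  "xbar1 scale c X A = ser_mult (\<lambda>n. X (- n - 1))
     (\<lambda>n v. if n > 0 then 0
            else exp_coeff scale
                   (\<lambda>r w. scale (- (q - inverse q) * (qh ^ ((4 + c) * r) / (1 + q ^ (2 * r)))) (A (int r) w))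
                   (nat (- n)) v)"

primrec xbar :: "(qfield \<Rightarrow> 'v::ab_group_add \<Rightarrow> 'v) \<Rightarrow> nat \<Rightarrow>
    (int \<Rightarrow> 'v \<Rightarrow> 'v) \<Rightarrow> (int \<Rightarrow> 'v \<Rightarrow> 'v) \<Rightarrow> nat \<Rightarrow> 'v ser" where
  "xbar scale c X A 0 = ser_one"
| "xbar scale c X A (Suc m) = ser_mult (xbar1 scale c X A) (dil scale 1 (xbar scale c X A m))"

definition xmode :: "(qfield \<Rightarrow> 'v::ab_group_add \<Rightarrow> 'v) \<Rightarrow> nat \<Rightarrow>
    (int \<Rightarrow> 'v \<Rightarrow> 'v) \<Rightarrow> (int \<Rightarrow> 'v \<Rightarrow> 'v) \<Rightarrow> nat \<Rightarrow> int \<Rightarrow> 'v \<Rightarrow> 'v" where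
  "xmode scale c X A m r = xbar scale c X A m (- r - int m)"

definition Sgen :: "(qfield \<Rightarrow> 'v::ab_group_add \<Rightarrow> 'v) \<Rightarrow> nat \<Rightarrow>
    (int \<Rightarrow> 'v \<Rightarrow> 'v) \<Rightarrow> (int \<Rightarrow> 'v \<Rightarrow> 'v) \<Rightarrow> 'v ser set" where
  "Sgen scale c X A = {dil scale l (xbar1 scale c X A) | l. True}"


section \<open>The linear relations contained in the equalities\<close>

text \<open>Apply an equality with index \<open>l\<close> to a vector \<open>v\<close> and compare the coefficients of
  \<open>z\<^bsup>-N-m-k-l\<^esup>\<close>; this gives one linear relation between the vectors
  \<open>\<langle>m', t\<rangle> = xmode m' t (xmode (m + k - m') (N - t) v)\<close>.  The coefficient of \<open>\<langle>m', t\<rangle>\<close> in an expression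
  that is bilinear in the two series is obtained by replacing the series by their monomials
  \<open>z\<^bsup>-t-m'\<^esup>\<close> and \<open>z\<^bsup>-(N-t)-(m+k-m')\<^esup>\<close>, i.e. by evaluating the same expression over the
  one-dimensional space.  \<open>rel1\<close> and \<open>rel2\<close> are the coefficients of left minus right hand side of
  the first and second equality with structure constants \<open>\<kappa> l j\<close>.\<close>

definition zmono :: "int \<Rightarrow> qfield ser" where
  "zmono s n x = (if n = s then x else 0)"

definition mono_of :: "nat \<Rightarrow> int \<Rightarrow> qfield ser" where
  "mono_of m' t = zmono (- t - int m')"

definition rel1 :: "(nat \<Rightarrow> nat \<Rightarrow> qfield) \<Rightarrow> nat \<Rightarrow> nat \<Rightarrow> int \<Rightarrow> nat \<Rightarrow> nat \<Rightarrow> int \<Rightarrow> qfield" where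
  "rel1 \<kappa> m k N l m' t =
     (let D = - N - int m - int k - int l;
          a = mono_of m' t;
          b = mono_of (m + k - m') (N - t)
      in (if m' = m then qprod (*) a (- int l - 1) (dil (*) 1 b) D 1 else 0)
         - (\<Sum>j\<le>l. if m' = m - 1 - j
                    then \<kappa> l j * zshift l (ser_mult (dil (*) (l + 1) a) (dil (*) (l - j) b)) D 1
                    else 0))"

definition rel2 :: "(nat \<Rightarrow> nat \<Rightarrow> qfield) \<Rightarrow> nat \<Rightarrow> nat \<Rightarrow> int \<Rightarrow> nat \<Rightarrow> nat \<Rightarrow> int \<Rightarrow> qfield" where
  "rel2 \<kappa> m k N l m' t =
     (let D = - N - int m - int k - int l;
          a = mono_of m' t;
          b = mono_of (m + k - m') (N - t)
      in (if m' = m then qprod (*) (dil (*) k a) (- int l - 1) b D 1 else 0)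
         - (\<Sum>j\<le>l. if m' = j
                    then \<kappa> l j * zshift l (ser_mult (dil (*) (k + l - j) a) (dil (*) l b)) D 1
                    else 0))"

end

theory Submission
  imports Defs
begin

text \<open>
  A vector of \<open>L\<close> is killed by all operators of sufficiently large degree for \<open>q\<^sup>d\<close>, so \<open>xbar1\<close> lies in
  \<open>Hom(L, L((z)))\<close>; its modes commute because dressing by the exponential turns the quadratic relation of
  \<open>x\<^sup>+(z)\<close> into \<open>(z\<^sub>1 - z\<^sub>2)[Y(z\<^sub>1), Y(z\<^sub>2)] = 0\<close>, which makes \<open>[Y(r), Y(s)]\<close> a function of \<open>r + s\<close> that is
  antisymmetric in \<open>r, s\<close>.  The \<open>l\<close>-th \<open>q\<close>-derivative of \<open>a(z)\<close> is \<open>z\<^bsup>-l\<^esup>\<close> times a combination of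
  \<open>a(z), a(zp), \<dots>, a(zp\<^sup>l)\<close>, \<open>p = q\<^sup>2\<close>, and the factors of \<open>x\<^sub>m(zp\<^sup>j)\<close> and \<open>x\<^sub>k(zp\<^bsup>l+1\<^esup>)\<close> regroup into a longer
  and a shorter string; this gives both families of equalities with \<open>c\<^sub>l\<^sub>j = d\<^sub>l\<^sub>j\<close>.  The linear relations
  can be solved for \<open>2m\<close> consecutive vectors because their coefficient matrix is, up to a triangular base
  change, a Vandermonde matrix.
\<close>

section \<open>The ground field\<close>

text \<open>A product of two series is an infinite sum, and lower truncation of the factors does not
  make it finite: it bounds the exponent of the inner series on a given vector, while the outer one
  meets a different vector for each exponent. Commutativity of the modes supplies the missing bound.
  It therefore comes before every identity, and a bicommutant passes it on to all strings. The last
  claim admits only the stated relations, so the elimination takes place on the scalars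
  \<open>rel1\<close> and \<open>rel2\<close>, before a vector of \<open>L\<close> is chosen. With
  \<open>w = p^t\<close>, row \<open>l\<close> of the first family is \<open>w\<close> times a
  polynomial of degree \<open>l\<close>, and row \<open>l\<close> of the second is
  \<open>w^(-k)\<close> times the same polynomial, up to factors free of \<open>t\<close>. The
  exponents 1, ..., m and -k, ..., m-1-k are disjoint because \<open>m <= k\<close>, and this makes
  the 2m rows independent.\<close>

lemma qh_power: "qh ^ n = Fract (monom 1 n) 1"
  by (induction n) (simp_all add: qh_def One_fract_def monom_altdef flip: one_pCons)

lemma qh_nonzero [simp]: "qh \<noteq> 0"
  by (simp add: qh_def Zero_fract_def eq_fract)

lemma q_nonzero [simp]: "q \<noteq> 0"
  by (simp add: q_def)

lemma qq_nonzero [simp]: "qq \<noteq> 0"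
  by (simp add: qq_def)

lemma qh_power_eq_1_iff: "qh ^ n = 1 \<longleftrightarrow> n = 0"
proof
  assume "qh ^ n = 1"
  then have "monom 1 n = (1 :: complex poly)"
    by (simp add: qh_power One_fract_def eq_fract)
  then have "degree (monom (1 :: complex) n) = 0"
    by simp
  then show "n = 0"
    by (simp add: degree_monom_eq)
qed simp

lemma q_power_eq_1_iff: "q ^ n = 1 \<longleftrightarrow> n = 0"
  by (simp add: q_def qh_power_eq_1_iff flip: power_mult)

lemma qq_power_eq_1_iff: "qq ^ n = 1 \<longleftrightarrow> n = 0"
  by (simp add: qq_def q_power_eq_1_iff flip: power_mult)

lemma powi_inject_of_not_root_of_unity:
  fixes x :: "'a::field"
  assumes "x \<noteq> 0" "\<And>n::nat. x ^ n = 1 \<Longrightarrow> n = 0"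
  shows "x powi r = x powi s \<longleftrightarrow> r = s"
proof
  have *: "r \<le> s \<Longrightarrow> x powi r = x powi s \<Longrightarrow> r = s" for r s
  proof -
    assume "r \<le> s" and eq: "x powi r = x powi s"
    have "x powi s = x powi r * x ^ nat (s - r)"
      using power_int_add[of x r "s - r"] assms(1) \<open>r \<le> s\<close> by (simp add: power_int_def)
    then have "x ^ nat (s - r) = 1"
      using eq assms(1) by simp
    then show "r = s"
      using assms(2) \<open>r \<le> s\<close> by fastforce
  qed
  assume "x powi r = x powi s"
  then show "r = s"
    using *[of r s] *[of s r] by (cases "r \<le> s") auto
qed simp

lemma q_powi_inject: "q powi r = q powi s \<longleftrightarrow> r = s"
  by (rule powi_inject_of_not_root_of_unity) (simp_all add: q_power_eq_1_iff)

lemma qq_powi_inject: "qq powi r = qq powi s \<longleftrightarrow> r = s"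
  by (rule powi_inject_of_not_root_of_unity) (simp_all add: qq_power_eq_1_iff)

lemma qq_neq_1 [simp]: "qq \<noteq> 1"
  using qq_power_eq_1_iff[of 1] by simp

lemma q_minus_inverse_nonzero: "q - inverse q \<noteq> 0"
proof
  assume "q - inverse q = 0"
  then have "q = inverse q"
    by simp
  then have "q * q = 1"
    by (metis q_nonzero right_inverse)
  then have "q ^ 2 = 1"
    by (simp add: power2_eq_square)
  then show False
    by (simp add: q_power_eq_1_iff)
qed

lemma one_plus_q_power_nonzero:
  assumes "r > 0"
  shows "1 + q ^ (2 * r) \<noteq> 0"
proof
  assume *: "1 + q ^ (2 * r) = 0"
  have "q ^ (4 * r) - 1 = (1 + q ^ (2 * r)) * (q ^ (2 * r) - 1)"
    by (simp add: algebra_simps flip: power_add)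
  then have "q ^ (4 * r) = 1"
    using * by simp
  then show False
    using assms by (simp add: q_power_eq_1_iff)
qed

lemma of_nat_qfield_eq_0_iff: "(of_nat n :: qfield) = 0 \<longleftrightarrow> n = 0"
  by (simp add: of_nat_fract Zero_fract_def eq_fract)

lemma qqfact_nonzero [simp]: "qqfact n \<noteq> 0"
  by (auto simp: qqfact_def qqint_def qq_power_eq_1_iff)

section \<open>Closure of the subfield C(q) under the field operations\<close>

lemma CqI: "g \<noteq> 0 \<Longrightarrow> Fract (pcompose f [:0, 0, 1:]) (pcompose g [:0, 0, 1:]) \<in> Cq"
  unfolding Cq_def by blast

lemma CqE:
  assumes "x \<in> Cq"
  obtains f g where "g \<noteq> 0" "pcompose g [:0, 0, 1:] \<noteq> 0"
    "x = Fract (pcompose f [:0, 0, 1:]) (pcompose g [:0, 0, 1:])"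
proof -
  obtain f g where "g \<noteq> 0" "x = Fract (pcompose f [:0, 0, 1:]) (pcompose g [:0, 0, 1:])"
    using assms unfolding Cq_def by blast
  \<comment> \<open>Substituting a nonconstant polynomial annihilates no nonzero polynomial; the
    arithmetic of \<open>Fract\<close> needs this for its denominators.\<close>
  moreover from \<open>g \<noteq> 0\<close> have "pcompose g [:0, 0, 1:] \<noteq> 0"
    by (metis pcompose_eq_0 degree_pCons_eq one_neq_zero pCons_eq_0_iff zero_less_Suc)
  ultimately show thesis
    using that by blast
qed

lemma Cq_0 [simp]: "0 \<in> Cq"
  using CqI[of 1 0] by (simp add: pcompose_1 Zero_fract_def)

lemma Cq_1 [simp]: "1 \<in> Cq"
  using CqI[of 1 1] by (simp add: pcompose_1 One_fract_def)

lemma Cq_add [intro]: assumes "x \<in> Cq" "y \<in> Cq" shows "x + y \<in> Cq"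
proof -
  obtain f g f' g' where
    fg: "g \<noteq> 0" "pcompose g [:0, 0, 1:] \<noteq> 0" "g' \<noteq> 0" "pcompose g' [:0, 0, 1:] \<noteq> 0"
      "x = Fract (pcompose f [:0, 0, 1:]) (pcompose g [:0, 0, 1:])"
      "y = Fract (pcompose f' [:0, 0, 1:]) (pcompose g' [:0, 0, 1:])"
    using assms by (elim CqE)
  then show ?thesis
    using CqI[of "g * g'" "f * g' + f' * g"] by (simp add: pcompose_add pcompose_mult)
qed

lemma Cq_mult [intro]: assumes "x \<in> Cq" "y \<in> Cq" shows "x * y \<in> Cq"
proof -
  obtain f g f' g' where
    fg: "g \<noteq> 0" "g' \<noteq> 0"
      "x = Fract (pcompose f [:0, 0, 1:]) (pcompose g [:0, 0, 1:])"
      "y = Fract (pcompose f' [:0, 0, 1:]) (pcompose g' [:0, 0, 1:])"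
    using assms by (elim CqE)
  then show ?thesis
    using CqI[of "g * g'" "f * f'"] by (simp add: pcompose_mult)
qed

lemma Cq_uminus [intro]: assumes "x \<in> Cq" shows "- x \<in> Cq"
proof -
  obtain f g where "g \<noteq> 0" "x = Fract (pcompose f [:0, 0, 1:]) (pcompose g [:0, 0, 1:])"
    using assms by (elim CqE)
  then show ?thesis
    using CqI[of g "- f"] by (simp add: pcompose_uminus)
qed

lemma Cq_diff [intro]: "x \<in> Cq \<Longrightarrow> y \<in> Cq \<Longrightarrow> x - y \<in> Cq"
  using Cq_add[of x "- y"] by auto

lemma Cq_inverse [intro]: assumes "x \<in> Cq" shows "inverse x \<in> Cq"
proof (cases "x = 0")
  case False
  obtain f g where fg: "g \<noteq> 0" "x = Fract (pcompose f [:0, 0, 1:]) (pcompose g [:0, 0, 1:])"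
    using assms by (elim CqE)
  then have "f \<noteq> 0"
    using False by (auto simp: fract_collapse)
  with fg show ?thesis
    using CqI[of f g] by simp
qed simp

lemma Cq_divide [intro]: "x \<in> Cq \<Longrightarrow> y \<in> Cq \<Longrightarrow> x / y \<in> Cq"
  by (simp add: divide_inverse Cq_mult Cq_inverse)

lemma Cq_power [intro]: "x \<in> Cq \<Longrightarrow> x ^ n \<in> Cq"
  by (induction n) auto

lemma Cq_prod: "(\<And>i. i \<in> A \<Longrightarrow> f i \<in> Cq) \<Longrightarrow> prod f A \<in> Cq"
  by (induction A rule: infinite_finite_induct) auto

lemma qq_in_Cq [simp]: "qq \<in> Cq"
proof -
  have "q = Fract [:0, 0, 1:] 1"
    unfolding q_def qh_power by (simp add: monom_altdef power2_eq_square)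
  then have "q \<in> Cq"
    using CqI[of 1 "[:0, 1:]"] by (simp add: pcompose_1 pcompose_pCons)
  then show ?thesis
    by (auto simp: qq_def)
qed

lemma qqfact_in_Cq [simp]: "qqfact n \<in> Cq"
  unfolding qqfact_def qqint_def by (intro Cq_prod Cq_divide Cq_diff Cq_power) auto


section \<open>Coefficients of iterated \<open>q\<close>-derivatives\<close>

text \<open>On the coefficient of \<open>z\<^sup>n\<close>, the operator \<open>z\<^sup>l \<partial>\<^sup>l / [l]!\<close> (where \<open>\<partial>\<close> is the \<open>q\<close>-derivative)
  acts as the value of this polynomial at \<open>p\<^sup>n\<close>, \<open>p = q\<^sup>2\<close>.\<close>

definition qder_poly :: "nat \<Rightarrow> qfield poly" where
  "qder_poly l = smult (1 / ((qq - 1) ^ l * qqfact l)) (\<Prod>i<l. [:- 1, inverse qq ^ i:])"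

text \<open>At \<open>u = p^s\<close> this is the Gaussian binomial coefficient of \<open>s\<close>
  over \<open>l\<close>: the \<open>l\<close>-th derivative of \<open>z^s\<close> carries the factor
  \<open>[s][s-1]...[s-l+1]\<close>.\<close>

lemma poly_qder_poly:
  "poly (qder_poly l) u = (\<Prod>i<l. (u * inverse qq ^ i - 1) / (qq - 1)) / qqfact l"
  by (simp add: qder_poly_def poly_prod prod_dividef)

lemma degree_qder_poly: "degree (qder_poly l) = l"
proof -
  have "degree (\<Prod>i<l. [:- 1, inverse qq ^ i:]) = (\<Sum>i<l. degree [:- 1, inverse qq ^ i:])"
    by (intro degree_prod_eq_sum_degree) auto
  then show ?thesis
    by (simp add: qder_poly_def)
qed

text \<open>These coefficients, in reversed order, become the structure constants of both families
  of equalities.\<close>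

lemma coeff_qder_poly_in_Cq: "coeff (qder_poly l) j \<in> Cq"
proof -
  have "\<forall>j. coeff (\<Prod>i<l. [:- 1, inverse qq ^ i:]) j \<in> Cq"
  proof (induction l)
    case (Suc l)
    have "coeff ([:- 1, b:] * P) j \<in> Cq" if "b \<in> Cq" "\<forall>j. coeff P j \<in> Cq" for b P j
      using that by (cases j) (auto intro!: Cq_diff Cq_mult)
    from this[of "inverse qq ^ l", OF _ Suc] show ?case
      unfolding prod.lessThan_Suc
      by (subst mult.commute) (simp only: Cq_power Cq_inverse qq_in_Cq simp_thms)
  qed (auto simp: coeff_1)
  then show ?thesis
    unfolding qder_poly_def coeff_smult
    by (intro Cq_mult Cq_divide Cq_power Cq_diff) simp_all
qed


section \<open>Interpolation\<close>

text \<open>Triangular elimination: a multiple of the top \<open>P m\<close> cancels the coefficient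
  of degree \<open>m\<close>, and the remainder is handled by induction.\<close>

lemma poly_combination_of_degrees:
  fixes P :: "nat \<Rightarrow> 'a::field poly"
  assumes "\<And>l. l < m \<Longrightarrow> P l \<noteq> 0 \<and> degree (P l) = l" and "Q = 0 \<or> degree Q < m"
  shows "\<exists>\<mu>. Q = (\<Sum>l<m. smult (\<mu> l) (P l))"
  using assms
proof (induction m arbitrary: Q)
  case (Suc m)
  define d where "d = coeff Q m / coeff (P m) m"
  define R where "R = Q - smult d (P m)"
  have Pm: "P m \<noteq> 0" "degree (P m) = m"
    using Suc.prems(1)[of m] by auto
  then have "coeff (P m) m \<noteq> 0"
    by (metis leading_coeff_0_iff)
  then have "coeff R m = 0"
    by (simp add: R_def d_def)
  moreover have "degree R \<le> m"
    unfolding R_def using Suc.prems(2) Pm by (intro degree_diff_le) auto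
  ultimately have "R = 0 \<or> degree R < m"
    by (metis eq_zero_or_degree_less)
  then obtain \<mu> where \<mu>: "R = (\<Sum>l<m. smult (\<mu> l) (P l))"
    using Suc.IH[of R] Suc.prems(1) by auto
  have "Q = (\<Sum>l<Suc m. smult ((\<mu>(m := d)) l) (P l))"
    using \<mu> by (simp add: R_def algebra_simps)
  then show ?case
    by blast
qed auto

text \<open>Lagrange interpolation writes the coefficient of \<open>X\<^sup>h\<close> of a polynomial of degree less than \<open>M\<close>
  as a combination of its values at \<open>M\<close> nodes.\<close>

lemma vandermonde_dual_solution:
  fixes x :: "nat \<Rightarrow> 'a::field"
  assumes inj: "inj_on x {..<M}" and "h < M"
  shows "\<exists>\<alpha>. \<forall>g<M. (\<Sum>j<M. \<alpha> j * x j ^ g) = (if g = h then 1 else 0)"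
proof -
  define num where "num j = (\<Prod>i\<in>{..<M} - {j}. [:- x i, 1:])" for j
  define lag where "lag j = smult (1 / poly (num j) (x j)) (num j)" for j
  have nz: "poly (num j) (x j) \<noteq> 0" if "j < M" for j
    using that inj by (auto simp: num_def poly_prod inj_on_def)
  have lag: "poly (lag j) (x i) = (if i = j then 1 else 0)" if "i < M" "j < M" for i j
    using that nz[of j] by (auto simp: lag_def num_def poly_prod)
  have deg: "degree (lag j) < M" if "j < M" for j
  proof -
    have "degree (num j) = (\<Sum>i\<in>{..<M} - {j}. degree [:- x i, 1:])"
      unfolding num_def by (intro degree_prod_eq_sum_degree) auto
    then have "degree (num j) < M"
      using that by simp
    then show ?thesis
      unfolding lag_def by (meson degree_smult_le le_less_trans)
  qed
  have card: "card (x ` {..<M}) = M"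
    using inj by (simp add: card_image)
  have "(\<Sum>j<M. coeff (lag j) h * x j ^ g) = (if g = h then 1 else 0)" if "g < M" for g
  proof -
    \<comment> \<open>The error of the interpolant of \<open>X^g\<close>: of degree below
      \<open>M\<close> with \<open>M\<close> distinct roots, hence zero. Its coefficient at
      \<open>X^h\<close> is the claim.\<close>
    define D where "D = (\<Sum>j<M. smult (x j ^ g) (lag j)) - monom 1 g"
    have "D = 0"
    proof (rule ccontr)
      assume "D \<noteq> 0"
      have "poly D (x i) = 0" if "i < M" for i
      proof -
        have "(\<Sum>j<M. x j ^ g * poly (lag j) (x i)) = (\<Sum>j<M. if j = i then x i ^ g else 0)"
          using that by (intro sum.cong) (auto simp: lag)
        then show ?thesis
          using that by (simp add: D_def poly_sum poly_monom)
      qed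
      then have "x ` {..<M} \<subseteq> {z. poly D z = 0}"
        by auto
      then have "M \<le> degree D"
        using card_poly_roots_bound[OF \<open>D \<noteq> 0\<close>] card_mono[OF poly_roots_finite[OF \<open>D \<noteq> 0\<close>]] card
        by (metis le_trans)
      moreover have "degree D < M"
        unfolding D_def
        using \<open>g < M\<close> deg le_less_trans[OF degree_smult_le deg]
        by (intro degree_diff_less degree_sum_less) (simp_all add: degree_monom_eq)
      ultimately show False
        by simp
    qed
    then have "coeff (\<Sum>j<M. smult (x j ^ g) (lag j)) h = coeff (monom 1 g) h"
      by (simp add: D_def)
    then show ?thesis
      by (simp add: coeff_sum mult.commute)
  qed
  then show ?thesis
    by (intro exI[of _ "\<lambda>j. coeff (lag j) h"]) simp
qed

section \<open>Operators of large degree annihilate a given vector\<close>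

lemma (in vector_space) linear_endo_iff:
  "Vector_Spaces.linear scale scale T \<longleftrightarrow>
     (\<forall>u v. T (u + v) = T u + T v) \<and> (\<forall>k v. T (scale k v) = scale k (T v))"
  by (auto simp: linear_iff_module_hom module_hom_iff module_axioms)

lemma (in vector_space) linear_endo_simps:
  assumes "Vector_Spaces.linear scale scale T"
  shows "T (u + v) = T u + T v" "T (u - v) = T u - T v" "T (- v) = - T v"
    "T (scale k v) = scale k (T v)" "T 0 = 0"
proof -
  interpret module_hom scale scale T
    using assms by (simp add: linear_iff_module_hom)
  show "T (u + v) = T u + T v" "T (u - v) = T u - T v" "T (- v) = - T v"
    "T (scale k v) = scale k (T v)" "T 0 = 0"
    by (simp_all add: add diff neg scale zero)
qed

lemma (in vector_space) linear_endo_sum: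
  assumes "Vector_Spaces.linear scale scale T"
  shows "T (\<Sum>i\<in>I. g i) = (\<Sum>i\<in>I. T (g i))"
  by (induction I rule: infinite_finite_induct) (simp_all add: linear_endo_simps[OF assms])

lemma (in vector_space) inv_eigenvector:
  assumes "Vector_Spaces.linear scale scale T" "bij T" "T w = scale k w" "k \<noteq> 0"
  shows "inv T w = scale (inverse k) w"
proof -
  have "T (scale (inverse k) w) = w"
    using assms by (simp add: linear_endo_simps)
  then show ?thesis
    using assms(2) by (metis bij_inv_eq_iff)
qed

context uq_affine_module
begin

text \<open>The index counts the factors \<open>f 0\<close> only, since the other \<open>f j\<close>
  commute with \<open>q^d\<close>.\<close>

inductive fmono :: "'v \<Rightarrow> nat \<Rightarrow> 'v \<Rightarrow> bool" for v0 where
  base: "fmono v0 0 v0"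
| step: "fmono v0 d w \<Longrightarrow> j \<le> n \<Longrightarrow> fmono v0 (if j = 0 then Suc d else d) (f j w)"

lemma fmono_K_eigenvector:
  assumes "fmono v0 d w" "i \<le> n" "K i v0 = scale (q powi z) v0"
  shows "\<exists>k. K i w = scale (q powi k) w"
  using assms
proof (induction rule: fmono.induct)
  case (step d w j)
  then obtain k where k: "K i w = scale (q powi k) w"
    by blast
  have linear_f: "Vector_Spaces.linear scale scale (f j)"
    using step lin_chevalley by blast
  have "K i (f j w) = scale (q powi (k - cartan n i j)) (f j w)"
    using K_f[of i j w] step.prems step.hyps
    by (simp add: k linear_endo_simps[OF linear_f] power_int_diff power_int_minus field_simps)
  then show ?case
    by blast
qed blast

lemma fmono_qd_eigenvector:
  assumes "fmono v0 d w" "qd v0 = scale (q powi b) v0"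
  shows "qd w = scale (q powi (b - int d)) w"
  using assms
proof (induction rule: fmono.induct)
  case (step d w j)
  have linear_f: "Vector_Spaces.linear scale scale (f j)"
    using step lin_chevalley by blast
  show ?case
    using qd_f[of j w] step
    by (auto simp: linear_endo_simps[OF linear_f] power_int_diff power_int_minus power_int_add field_simps)
qed simp

end

context integrable_highest_weight_module
begin

text \<open>A direct substitute for the triangular decomposition. The span is stable under every
  \<open>e i\<close>, since moving \<open>e i\<close> past a factor \<open>f j\<close> costs only a
  term in \<open>K i\<close> and its inverse, for which monomials are eigenvectors. Being generated
  by the highest weight vector, the module equals this span.\<close>

lemma span_fmono:
  obtains v0 b where "qd v0 = scale (q powi b) v0" "span {w. \<exists>d. fmono v0 d w} = UNIV"
proof -
  obtain v0 and \<Lambda> :: "nat \<Rightarrow> int" and b where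
    "\<forall>i\<le>n. e i v0 = 0 \<and> K i v0 = scale (q powi \<Lambda> i) v0"
    and qd0: "qd v0 = scale (q powi b) v0"
    and gen: "\<forall>W. module.subspace scale W \<and> v0 \<in> W \<and>
      (\<forall>i\<le>n. \<forall>w\<in>W. e i w \<in> W \<and> f i w \<in> W \<and> K i w \<in> W \<and> inv (K i) w \<in> W) \<and>
      (\<forall>w\<in>W. qd w \<in> W \<and> inv qd w \<in> W) \<longrightarrow> W = UNIV"
    using highest_weight by (elim exE conjE) (rule that)
  then have v0: "e i v0 = 0" "K i v0 = scale (q powi \<Lambda> i) v0" if "i \<le> n" for i
    using that by simp_all
  define M where "M = {w. \<exists>d. fmono v0 d w}"
  have ext: "T w \<in> span M"
    if "Vector_Spaces.linear scale scale T" "\<And>w. w \<in> M \<Longrightarrow> T w \<in> span M" "w \<in> span M" for T w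
    using that(3)
  proof (induction rule: span_induct_alt)
    case base
    then show ?case by (simp add: linear_endo_simps[OF that(1)] span_zero)
  next
    case (step k x y)
    then show ?case
      by (simp add: linear_endo_simps[OF that(1)] span_add span_scale that(2))
  qed
  have lin_inv: "Vector_Spaces.linear scale scale (inv T)"
    if "Vector_Spaces.linear scale scale T" "bij T" for T
    unfolding linear_endo_iff
    using that by (metis bij_inv_eq_iff linear_endo_simps(1,4))
  have lin: "Vector_Spaces.linear scale scale (e i)" "Vector_Spaces.linear scale scale (f i)"
    "Vector_Spaces.linear scale scale (K i)" "bij (K i)" if "i \<le> n" for i
    using that lin_chevalley by auto
  have Kw: "K i w \<in> span M \<and> inv (K i) w \<in> span M" if w: "w \<in> M" and i: "i \<le> n" for i w
  proof -
    obtain k where k: "K i w = scale (q powi k) w"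
      using w fmono_K_eigenvector[OF _ i v0(2)[OF i]] by (auto simp: M_def)
    have "inv (K i) w = scale (inverse (q powi k)) w"
      by (rule inv_eigenvector) (use lin i k in auto)
    with k w show ?thesis
      by (simp add: span_scale span_base)
  qed
  have qdw: "qd w \<in> span M \<and> inv qd w \<in> span M" if w: "w \<in> M" for w
  proof -
    obtain k where k: "qd w = scale (q powi k) w"
      using w fmono_qd_eigenvector[OF _ qd0] by (auto simp: M_def)
    have "inv qd w = scale (inverse (q powi k)) w"
      by (rule inv_eigenvector) (use lin_qd k in auto)
    with k w show ?thesis
      by (simp add: span_scale span_base)
  qed
  have fw: "f j w \<in> span M" if "w \<in> span M" "j \<le> n" for j w
  proof (rule ext[OF lin(2)[OF that(2)] _ that(1)])
    fix w assume "w \<in> M"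
    then have "f j w \<in> M"
      using that(2) fmono.step unfolding M_def by blast
    then show "f j w \<in> span M"
      by (rule span_base)
  qed
  have ew: "e i w \<in> span M" if w: "w \<in> M" and i: "i \<le> n" for i w
  proof -
    obtain d where "fmono v0 d w"
      using w by (auto simp: M_def)
    then show ?thesis
    proof (induction rule: fmono.induct)
      case base
      then show ?case using v0 i by (simp add: span_zero)
    next
      case (step d w j)
      then have "w \<in> M"
        by (auto simp: M_def)
      have "e i (f j w) = f j (e i w) +
          (if i = j then scale (1 / (q - inverse q)) (K i w - inv (K i) w) else 0)"
        using e_f[OF i step.hyps(2), of w] unfolding diff_eq_eq by (simp only: add.commute)
      also have "\<dots> \<in> span M"
        using fw[OF step.IH step.hyps(2)] Kw[OF \<open>w \<in> M\<close> i]
        by (cases "i = j") (simp_all add: span_add span_scale span_diff)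
      finally show ?case .
    qed
  qed
  have "span M = UNIV"
  proof (intro gen[rule_format] conjI allI impI ballI)
    show "v0 \<in> span M"
      by (auto simp: M_def intro: span_base fmono.base)
    fix w assume w: "w \<in> span M"
    show "qd w \<in> span M" "inv qd w \<in> span M"
      using ext[OF conjunct1[OF lin_qd] conjunct1[OF qdw] w]
        ext[OF lin_inv[OF conjunct1[OF lin_qd] conjunct2[OF lin_qd]] conjunct2[OF qdw] w] by simp_all
    fix i assume i: "i \<le> n"
    show "e i w \<in> span M" "f i w \<in> span M" "K i w \<in> span M" "inv (K i) w \<in> span M"
      using ext[OF lin(1)[OF i] ew[OF _ i] w] fw[OF w i]
        ext[OF lin(3)[OF i] conjunct1[OF Kw[OF _ i]] w]
        ext[OF lin_inv[OF lin(3)[OF i] lin(4)[OF i]] conjunct2[OF Kw[OF _ i]] w] by simp_all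
  qed simp
  with qd0 show thesis
    using that unfolding M_def by blast
qed

text \<open>The eigenvalues of \<open>q\<^sup>d\<close> on \<open>L\<close> are \<open>q\<^bsup>b\<^esup>, q\<^bsup>b-1\<^esup>, \<dots>\<close>, and an operator of degree \<open>N\<close> multiplies
  eigenvalues by \<open>q\<^sup>N\<close>.\<close>

lemma large_degree_vanishes:
  "\<exists>D::int. \<forall>N>D. \<forall>T. Vector_Spaces.linear scale scale T \<longrightarrow>
     (\<forall>w. qd (T w) = scale (q powi N) (T (qd w))) \<longrightarrow> T v = 0"
proof -
  obtain v0 b where qd0: "qd v0 = scale (q powi b) v0"
    and span: "span {w. \<exists>d. fmono v0 d w} = UNIV"
    by (rule span_fmono)
  \<comment> \<open>A product of \<open>q^d - q^(b-d)\<close> over an initial range of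
    \<open>d\<close>. Every vector is killed by some \<open>P D\<close>, but an eigenvector with
    exponent above \<open>b\<close> is killed by none; this avoids decomposing \<open>T x\<close>
    into eigenvectors.\<close>
  define P where "P D = foldr (\<lambda>d w. qd w - scale (q powi (b - int d)) w) [0..<D]" for D
  have lin_P: "Vector_Spaces.linear scale scale (\<lambda>w. P D w)" for D
  proof -
    have "Vector_Spaces.linear scale scale (\<lambda>w. foldr (\<lambda>d w. qd w - scale (q powi (b - int d)) w) ds w)"
      for ds
      by (induction ds)
         (simp_all add: linear_endo_iff conjunct1[OF lin_qd, THEN linear_endo_simps(1)]
            conjunct1[OF lin_qd, THEN linear_endo_simps(4)] scale_right_distrib
            scale_right_diff_distrib mult.commute)
    then show ?thesis
      by (simp add: P_def)
  qed
  have P_eigen: "P D w = scale (\<Prod>d<D. k - q powi (b - int d)) w" if "qd w = scale k w" for D k w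
  proof -
    have "foldr (\<lambda>d w. qd w - scale (q powi (b - int d)) w) ds w
        = scale (prod_list (map (\<lambda>d. k - q powi (b - int d)) ds)) w" for ds
      by (induction ds)
         (simp_all add: linear_endo_simps[OF conjunct1[OF lin_qd]] that scale_left_diff_distrib
            left_diff_distrib mult.commute)
    then show ?thesis
      by (simp add: P_def prod.list_conv_set_nth lessThan_atLeast0)
  qed
  have nilp: "\<exists>D0. \<forall>D\<ge>D0. P D w = 0" for w
  proof -
    have "w \<in> span {w. \<exists>d. fmono v0 d w}"
      by (simp add: span)
    then show ?thesis
    proof (induction rule: span_induct_alt)
      case base
      then show ?case by (simp add: linear_endo_simps[OF lin_P])
    next
      case (step k x y)
      then obtain d D1 where d: "fmono v0 d x" and D1: "\<forall>D\<ge>D1. P D y = 0"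
        by blast
      have "P D x = 0" if "D > d" for D
        using that by (auto simp: P_eigen[OF fmono_qd_eigenvector[OF d qd0]] intro!: prod_zero bexI[of _ d])
      then show ?case
        using D1 by (intro exI[of _ "max D1 (Suc d)"]) (simp add: linear_endo_simps[OF lin_P])
    qed
  qed
  have "v \<in> span {w. \<exists>d. fmono v0 d w}"
    by (simp add: span)
  then show ?thesis
  proof (induction rule: span_induct_alt)
    case base
    then show ?case by (auto simp: linear_endo_simps)
  next
    case (step k x y)
    then obtain d D1 where d: "fmono v0 d x"
      and D1: "\<And>N T. N > D1 \<Longrightarrow> Vector_Spaces.linear scale scale T \<Longrightarrow>
        \<forall>w. qd (T w) = scale (q powi N) (T (qd w)) \<Longrightarrow> T y = 0"
      by blast
    have Tx: "T x = 0" if N: "N > int d" and T: "Vector_Spaces.linear scale scale T"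
      and deg: "\<forall>w. qd (T w) = scale (q powi N) (T (qd w))" for N T
    proof -
      have "qd (T x) = scale (q powi (N + (b - int d))) (T x)"
        using fmono_qd_eigenvector[OF d qd0] deg by (simp add: linear_endo_simps[OF T] power_int_add)
      moreover obtain D where "P D (T x) = 0"
        using nilp by blast
      ultimately have "scale (\<Prod>d'<D. q powi (N + (b - int d)) - q powi (b - int d')) (T x) = 0"
        by (metis P_eigen)
      \<comment> \<open>\<open>N > d\<close> lifts the exponent \<open>N + b - d\<close> above each
        \<open>b - d'\<close>, and distinct powers of \<open>q\<close> differ.\<close>
      moreover have "(\<Prod>d'<D. q powi (N + (b - int d)) - q powi (b - int d')) \<noteq> 0"
        using N by (auto simp: q_powi_inject)
      ultimately show ?thesis
        by simp
    qed
    show ?case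
    proof (intro exI[of _ "max D1 (int d)"] allI impI)
      fix N T
      assume "max D1 (int d) < N" and T: "Vector_Spaces.linear scale scale T"
        and deg: "\<forall>w. qd (T w) = scale (q powi N) (T (qd w))"
      then show "T (scale k x + y) = 0"
        using D1[OF _ T deg] Tx[OF _ T deg] by (simp add: linear_endo_simps[OF T])
    qed
  qed
qed

end

section \<open>Exponentials of commuting operators\<close>

lemma pow_coeff_cong:
  assumes "\<And>r w. r \<ge> 1 \<Longrightarrow> A r w = A' r w"
  shows "pow_coeff A p N v = pow_coeff A' p N v"
  by (induction p arbitrary: N) (simp_all add: assms)

lemma exp_coeff_cong:
  assumes "\<And>r w. r \<ge> 1 \<Longrightarrow> A r w = A' r w"
  shows "exp_coeff scale A N v = exp_coeff scale A' N v"
  unfolding exp_coeff_def using pow_coeff_cong[OF assms] by simp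

lemma sum_triangle_swap:
  fixes g :: "nat \<Rightarrow> nat \<Rightarrow> 'a::comm_monoid_add"
  shows "(\<Sum>r\<le>N. \<Sum>j\<le>N - r. g r j) = (\<Sum>j\<le>N. \<Sum>r\<le>N - j. g r j)"
proof -
  have "(\<Sum>r\<le>N. \<Sum>j\<le>N - r. g r j) = (\<Sum>(r, j)\<in>{(r, j). r + j \<le> N}. g r j)"
    by (subst sum.Sigma) (auto intro!: sum.cong)
  also have "\<dots> = (\<Sum>(j, r)\<in>{(j, r). j + r \<le> N}. g r j)"
    by (rule sum.reindex_bij_witness[of _ prod.swap prod.swap]) auto
  also have "\<dots> = (\<Sum>j\<le>N. \<Sum>r\<le>N - j. g r j)"
    by (subst sum.Sigma) (auto intro!: sum.cong)
  finally show ?thesis .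
qed

lemma sum_triangle_diagonal:
  fixes g :: "nat \<Rightarrow> nat \<Rightarrow> 'a::comm_monoid_add"
  shows "(\<Sum>r\<le>N. \<Sum>j\<le>N - r. g r j) = (\<Sum>s\<le>N. \<Sum>r\<le>s. g r (s - r))"
  unfolding sum.triangle_reindex_eq[symmetric]
  by (subst sum.Sigma) (auto intro!: sum.cong)

text \<open>The normalisation \<open>B 0 = 0\<close> lets all sums start at \<open>r = 0\<close>,
  the shape that the triangular rearrangements require.\<close>

locale exp_operators = vector_space scale
  for scale :: "qfield \<Rightarrow> 'v::ab_group_add \<Rightarrow> 'v" +
  fixes B :: "nat \<Rightarrow> 'v \<Rightarrow> 'v"
  assumes lin_B: "Vector_Spaces.linear scale scale (B r)"
    and B_0: "B 0 v = 0"
    and B_B: "B r (B s v) = B s (B r v)"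
begin

abbreviation E :: "nat \<Rightarrow> 'v \<Rightarrow> 'v" where
  "E \<equiv> exp_coeff scale B"

lemmas B_simps = linear_endo_simps[OF lin_B] linear_endo_sum[OF lin_B]

lemma pow_coeff_Suc: "pow_coeff B (Suc p) N v = (\<Sum>r\<le>N. B r (pow_coeff B p (N - r) v))"
proof -
  have "(\<Sum>r\<le>N. B r (pow_coeff B p (N - r) v)) = (\<Sum>r = 1..N. B r (pow_coeff B p (N - r) v))"
    by (rule sum.mono_neutral_right) (auto simp: B_0 not_less_eq_eq)
  then show ?thesis
    by simp
qed

declare pow_coeff.simps(2) [simp del]

lemma lin_pow: "Vector_Spaces.linear scale scale (pow_coeff B p N)"
proof (induction p arbitrary: N)
  case (Suc p)
  show ?case
    unfolding linear_endo_iff pow_coeff_Suc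
    by (simp add: linear_endo_simps[OF Suc] B_simps sum.distrib scale_sum_right)
qed (auto simp: linear_endo_iff)

lemma lin_E: "Vector_Spaces.linear scale scale (E N)"
  unfolding linear_endo_iff exp_coeff_def
  by (simp add: linear_endo_simps[OF lin_pow] scale_right_distrib sum.distrib scale_sum_right mult.commute)

lemmas E_simps = linear_endo_simps[OF lin_E] linear_endo_sum[OF lin_E]

lemma pow_coeff_commute:
  assumes "Vector_Spaces.linear scale scale T" "\<And>r v. T (B r v) = B r (T v)"
  shows "T (pow_coeff B p N v) = pow_coeff B p N (T v)"
  by (induction p arbitrary: N)
     (simp_all add: pow_coeff_Suc linear_endo_simps[OF assms(1)] linear_endo_sum[OF assms(1)] assms(2))

lemma E_commute:
  assumes "Vector_Spaces.linear scale scale T" "\<And>r v. T (B r v) = B r (T v)"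
  shows "T (E N v) = E N (T v)"
  by (simp add: exp_coeff_def linear_endo_simps[OF assms(1)] linear_endo_sum[OF assms(1)]
      pow_coeff_commute[OF assms])

lemma E_E: "E M (E N v) = E N (E M v)"
  by (rule E_commute[OF lin_E]) (rule E_commute[OF lin_B B_B, symmetric])

lemma E_0: "E 0 v = v"
  by (simp add: exp_coeff_def)

lemma pow_coeff_eq_0: "N < p \<Longrightarrow> pow_coeff B p N v = 0"
proof (induction p arbitrary: N)
  case (Suc p)
  have "B r (pow_coeff B p (N - r) v) = 0" if "r \<le> N" for r
    using Suc that by (cases r) (auto simp: B_0 B_simps)
  then show ?case
    by (simp add: pow_coeff_Suc)
qed simp

text \<open>The chain rule for \<open>w d/dw\<close> applied to \<open>A(w)^(p+1)\<close>, read off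
  at \<open>w^N\<close>. The induction is the product rule; commutativity of the \<open>B r\<close>
  collects the terms.\<close>

lemma pow_coeff_derivative:
  "scale (of_nat N) (pow_coeff B (Suc p) N v) =
     scale (of_nat (Suc p)) (\<Sum>r\<le>N. scale (of_nat r) (B r (pow_coeff B p (N - r) v)))"
proof (induction p arbitrary: N)
  case 0
  have "(\<Sum>r\<le>N. B r (pow_coeff B 0 (N - r) v)) = (\<Sum>r\<le>N. if r = N then B N v else 0)"
    by (rule sum.cong) (auto simp: B_simps)
  moreover have "(\<Sum>r\<le>N. scale (of_nat r) (B r (pow_coeff B 0 (N - r) v))) =
      (\<Sum>r\<le>N. if r = N then scale (of_nat N) (B N v) else 0)"
    by (rule sum.cong) (auto simp: B_simps)
  ultimately show ?case
    by (simp only: pow_coeff_Suc) simp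
next
  case (Suc p)
  let ?P = "\<lambda>p N. pow_coeff B p N v"
  have "scale (of_nat N) (?P (Suc (Suc p)) N)
      = (\<Sum>r\<le>N. scale (of_nat r) (B r (?P (Suc p) (N - r))) +
              B r (scale (of_nat (N - r)) (?P (Suc p) (N - r))))"
    unfolding pow_coeff_Suc[of "Suc p"] scale_sum_right
    by (intro sum.cong) (auto simp: B_simps simp flip: scale_left_distrib of_nat_add)
  also have "\<dots> = (\<Sum>r\<le>N. scale (of_nat r) (B r (?P (Suc p) (N - r)))) +
      (\<Sum>r\<le>N. \<Sum>s\<le>N - r. scale (of_nat (Suc p)) (scale (of_nat s) (B s (B r (?P p (N - s - r))))))"
    unfolding Suc.IH sum.distrib by (simp add: B_simps scale_sum_right B_B add.commute)
  also have "(\<Sum>r\<le>N. \<Sum>s\<le>N - r. scale (of_nat (Suc p)) (scale (of_nat s) (B s (B r (?P p (N - s - r))))))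
      = scale (of_nat (Suc p)) (\<Sum>s\<le>N. scale (of_nat s) (B s (?P (Suc p) (N - s))))"
    unfolding pow_coeff_Suc[of p] by (subst sum_triangle_swap) (simp add: B_simps scale_sum_right)
  also have "(\<Sum>r\<le>N. scale (of_nat r) (B r (?P (Suc p) (N - r)))) + \<dots> =
      scale (of_nat (Suc (Suc p))) (\<Sum>r\<le>N. scale (of_nat r) (B r (?P (Suc p) (N - r))))"
    by (simp only: of_nat_Suc[of "Suc p"] scale_left_distrib scale_one)
  finally show ?case .
qed

text \<open>The differential equation \<open>w F' = (w A') F\<close> of \<open>F = exp A\<close>. In
  characteristic 0 it determines the coefficients recursively, so later arguments can induct on
  \<open>N\<close> instead of expanding the exponential.\<close>

lemma exp_derivative: "scale (of_nat N) (E N v) = (\<Sum>r\<le>N. scale (of_nat r) (B r (E (N - r) v)))"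
proof (cases N)
  case 0
  then show ?thesis by (simp add: B_0)
next
  case (Suc M)
  let ?P = "\<lambda>p N. pow_coeff B p N v"
  have fact: "1 / (of_nat (fact (Suc p)) :: qfield) * of_nat (Suc p) = 1 / of_nat (fact p)" for p
    using of_nat_qfield_eq_0_iff[of "Suc p"] unfolding fact_Suc of_nat_id of_nat_mult
    by (simp del: of_nat_Suc)
  \<comment> \<open>For \<open>r >= 1\<close> the range extends to \<open>p <= M\<close> because
    powers beyond \<open>N - r\<close> contribute nothing; the summand \<open>r = 0\<close> has the
    factor 0.\<close>
  have E: "E (N - r) v = (\<Sum>p\<le>M. scale (1 / of_nat (fact p)) (?P p (N - r)))" if "r \<ge> 1" for r
    unfolding exp_coeff_def using that Suc
    by (intro sum.mono_neutral_left) (auto simp: pow_coeff_eq_0)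
  have "scale (of_nat N) (E N v)
      = (\<Sum>p\<le>M. scale (1 / of_nat (fact (Suc p))) (scale (of_nat N) (?P (Suc p) N)))"
    unfolding exp_coeff_def Suc scale_sum_right
    by (subst sum.atMost_Suc_shift) (simp add: mult.commute)
  also have "\<dots> = (\<Sum>p\<le>M. \<Sum>r\<le>N. scale (of_nat r) (scale (1 / of_nat (fact p)) (B r (?P p (N - r)))))"
    unfolding pow_coeff_derivative scale_scale fact by (simp add: scale_sum_right mult.commute)
  also have "\<dots> = (\<Sum>r\<le>N. \<Sum>p\<le>M. scale (of_nat r) (scale (1 / of_nat (fact p)) (B r (?P p (N - r)))))"
    by (rule sum.swap)
  also have "\<dots> = (\<Sum>r\<le>N. scale (of_nat r) (B r (E (N - r) v)))"
  proof (rule sum.cong)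
    fix r
    show "(\<Sum>p\<le>M. scale (of_nat r) (scale (1 / of_nat (fact p)) (B r (?P p (N - r)))))
        = scale (of_nat r) (B r (E (N - r) v))"
      by (cases "r = 0") (simp_all add: E B_simps scale_sum_right)
  qed simp
  finally show ?thesis .
qed

end

section \<open>Commutativity of the Ding--Feigin operators\<close>

text \<open>Conjugation by \<open>E(w)\<close> multiplies \<open>X\<close> by \<open>(1 - q\<^sup>2wS) / (1 - wS)\<close>, where \<open>S\<close> raises the index of \<open>X\<close>
  by one; these are the Taylor coefficients of that function.\<close>

definition conj_coeff :: "nat \<Rightarrow> qfield" where
  "conj_coeff j = (if j = 0 then 1 else 1 - q ^ 2)"

text \<open>Logarithmic derivative of \<open>F = (1 - q^2 w) / (1 - w)\<close>:
  \<open>w F' / F\<close> is the sum of \<open>(1 - q^(2r)) w^r\<close> over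
  \<open>r >= 1\<close>.\<close>

lemma conj_coeff_recursion:
  "of_nat n * conj_coeff n = (\<Sum>r\<le>n. (1 - q ^ (2 * r)) * conj_coeff (n - r))"
proof -
  have "(\<Sum>r<n. (1 - q ^ (2 * r)) * (1 - q ^ 2)) = of_nat n * (1 - q ^ 2) - (1 - q ^ (2 * n))"
    by (induction n) (simp_all add: algebra_simps power2_eq_square)
  moreover have "(\<Sum>r<n. (1 - q ^ (2 * r)) * conj_coeff (n - r)) = (\<Sum>r<n. (1 - q ^ (2 * r)) * (1 - q ^ 2))"
    by (rule sum.cong) (auto simp: conj_coeff_def)
  ultimately have "(\<Sum>r\<le>n. (1 - q ^ (2 * r)) * conj_coeff (n - r)) = of_nat n * (1 - q ^ 2)"
    by (simp add: lessThan_Suc_atMost[symmetric] conj_coeff_def)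
  then show ?thesis
    by (simp add: conj_coeff_def)
qed

text \<open>\<open>B_X\<close> is cleared of the denominator \<open>r\<close>. \<open>Y_eq\<close>
  admits every bound \<open>R\<close> beyond which the exponential kills \<open>v\<close>, so
  finitely many vectors can share one truncation.\<close>

locale dressed_current = exp_operators scale B
  for scale :: "qfield \<Rightarrow> 'v::ab_group_add \<Rightarrow> 'v" and B :: "nat \<Rightarrow> 'v \<Rightarrow> 'v" +
  fixes X Y :: "int \<Rightarrow> 'v \<Rightarrow> 'v"
  assumes lin_X: "Vector_Spaces.linear scale scale (X l)"
    and B_X: "scale (of_nat r) (B r (X l v)) =
      scale (of_nat r) (X l (B r v)) + scale (1 - q ^ (2 * r)) (X (l + int r) v)"
    and X_X: "X (k + 1) (X l v) - scale (q ^ 2) (X l (X (k + 1) v)) =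
      scale (q ^ 2) (X k (X (l + 1) v)) - X (l + 1) (X k v)"
    and E_vanishes: "\<exists>R. \<forall>N\<ge>R. exp_coeff scale B N v = 0"
    and Y_eq: "\<forall>N\<ge>R. exp_coeff scale B N v = 0 \<Longrightarrow>
      Y l v = (\<Sum>N<R. X (l - int N) (exp_coeff scale B N v))"
begin

lemmas X_simps = linear_endo_simps[OF lin_X] linear_endo_sum[OF lin_X]

text \<open>Both sides obey the recursion of \<open>exp_derivative\<close>: the commutators of the
  \<open>B r\<close> with \<open>X\<close> produce exactly the right side of
  \<open>conj_coeff_recursion\<close>.\<close>

lemma E_X: "E N (X l v) = (\<Sum>j\<le>N. scale (conj_coeff j) (X (l + int j) (E (N - j) v)))"
proof (induction N arbitrary: l v rule: less_induct)
  case (less N)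
  show ?case
  proof (cases "N = 0")
    case True
    then show ?thesis by (simp add: E_0 conj_coeff_def)
  next
    case False
    \<comment> \<open>\<open>?t\<close> has \<open>B r\<close> moved to the right of
      \<open>X\<close>, \<open>?u\<close> is the commutator. They resum to the weights
      \<open>N - j\<close> and \<open>j\<close>, which add up to \<open>N\<close>.\<close>
    let ?t = "\<lambda>r j. scale (conj_coeff j) (X (l + int j) (scale (of_nat r) (B r (E (N - j - r) v))))"
    let ?u = "\<lambda>r j. scale ((1 - q ^ (2 * r)) * conj_coeff j) (X (l + int (r + j)) (E (N - (r + j)) v))"
    have summand: "scale (of_nat r) (B r (E (N - r) (X l v))) = (\<Sum>j\<le>N - r. ?t r j + ?u r j)"
      if "r \<le> N" for r
    proof (cases "r = 0")
      case True
      then show ?thesis by (simp add: B_0 X_simps)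
    next
      case False
      have "scale (of_nat r) (B r (E (N - r) (X l v)))
          = (\<Sum>j\<le>N - r. scale (conj_coeff j) (scale (of_nat r) (B r (X (l + int j) (E (N - r - j) v)))))"
        using less[of "N - r"] False \<open>r \<le> N\<close>
        by (simp add: B_simps scale_sum_right mult.commute)
      also have "\<dots> = (\<Sum>j\<le>N - r. ?t r j + ?u r j)"
        unfolding B_X
        by (simp add: X_simps scale_right_distrib mult.commute add.commute add.left_commute)
      finally show ?thesis .
    qed
    have "scale (of_nat N) (E N (X l v)) = (\<Sum>r\<le>N. \<Sum>j\<le>N - r. ?t r j + ?u r j)"
      unfolding exp_derivative by (rule sum.cong) (auto simp: summand)
    also have "\<dots> = (\<Sum>r\<le>N. \<Sum>j\<le>N - r. ?t r j) + (\<Sum>r\<le>N. \<Sum>j\<le>N - r. ?u r j)"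
      by (simp only: sum.distrib)
    also have "(\<Sum>r\<le>N. \<Sum>j\<le>N - r. ?t r j)
        = (\<Sum>j\<le>N. scale (conj_coeff j) (X (l + int j) (scale (of_nat (N - j)) (E (N - j) v))))"
      unfolding exp_derivative by (subst sum_triangle_swap) (simp add: X_simps scale_sum_right)
    also have "(\<Sum>r\<le>N. \<Sum>j\<le>N - r. ?u r j) =
        (\<Sum>n\<le>N. scale (\<Sum>r\<le>n. (1 - q ^ (2 * r)) * conj_coeff (n - r)) (X (l + int n) (E (N - n) v)))"
      by (subst sum_triangle_diagonal) (simp add: scale_sum_left)
    also have "\<dots> = (\<Sum>j\<le>N. scale (of_nat j * conj_coeff j) (X (l + int j) (E (N - j) v)))"
      by (simp only: conj_coeff_recursion)
    also have "(\<Sum>j\<le>N. scale (conj_coeff j) (X (l + int j) (scale (of_nat (N - j)) (E (N - j) v)))) + \<dots>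
        = (\<Sum>j\<le>N. scale (of_nat (N - j) * conj_coeff j + of_nat j * conj_coeff j) (X (l + int j) (E (N - j) v)))"
      by (simp add: X_simps sum.distrib scale_left_distrib mult.commute)
    also have "\<dots> = (\<Sum>j\<le>N. scale (of_nat N * conj_coeff j) (X (l + int j) (E (N - j) v)))"
      by (rule sum.cong) (auto simp: simp flip: distrib_right of_nat_add)
    finally have "scale (of_nat N) (E N (X l v)) =
        scale (of_nat N) (\<Sum>j\<le>N. scale (conj_coeff j) (X (l + int j) (E (N - j) v)))"
      by (simp add: scale_sum_right)
    then show ?thesis
      using False by (simp add: of_nat_qfield_eq_0_iff)
  qed
qed

text \<open>The conjugation formula with its denominator cleared,
  \<open>(1 - wS) E(w) X = (1 - q^2 wS) X E(w)\<close>, at \<open>w^(N+1)\<close>; only two terms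
  remain on each side.\<close>

lemma E_X_exchange:
  "E (Suc N) (X l v) - E N (X (l + 1) v) = X l (E (Suc N) v) - scale (q ^ 2) (X (l + 1) (E N v))"
proof -
  have "E (Suc N) (X l v) = X l (E (Suc N) v) +
      (\<Sum>j\<le>N. scale (1 - q ^ 2) (X (l + 1 + int j) (E (N - j) v)))"
    unfolding E_X[of "Suc N"]
    by (subst sum.atMost_Suc_shift) (simp add: conj_coeff_def add.assoc)
  moreover have "E N (X (l + 1) v) = scale (q ^ 2) (X (l + 1) (E N v)) +
      (\<Sum>j\<le>N. scale (1 - q ^ 2) (X (l + 1 + int j) (E (N - j) v)))"
  proof (cases N)
    case 0
    then show ?thesis by (simp add: E_0 scale_left_diff_distrib)
  next
    case (Suc M)
    have "E N (X (l + 1) v) = X (l + 1) (E N v) +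
        (\<Sum>j\<le>M. scale (1 - q ^ 2) (X (l + 1 + int (Suc j)) (E (N - Suc j) v)))"
      unfolding E_X Suc by (subst sum.atMost_Suc_shift) (simp add: conj_coeff_def)
    moreover have "(\<Sum>j\<le>N. scale (1 - q ^ 2) (X (l + 1 + int j) (E (N - j) v))) =
        scale (1 - q ^ 2) (X (l + 1) (E N v)) +
        (\<Sum>j\<le>M. scale (1 - q ^ 2) (X (l + 1 + int (Suc j)) (E (N - Suc j) v)))"
      unfolding Suc by (subst sum.atMost_Suc_shift) simp
    ultimately show ?thesis
      by (simp add: scale_left_diff_distrib)
  qed
  ultimately show ?thesis
    by simp
qed

lemma E_vanishes_uniformly:
  assumes "finite V"
  shows "\<exists>R. \<forall>N\<ge>R. \<forall>v\<in>V. E N v = 0"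
  using assms
proof induction
  case (insert v V)
  then obtain R where "\<forall>N\<ge>R. \<forall>v\<in>V. E N v = 0"
    by blast
  moreover obtain R' where "\<forall>N\<ge>R'. E N v = 0"
    using E_vanishes by blast
  ultimately show ?case
    by (intro exI[of _ "max R R'"]) auto
qed simp

lemma lin_Y: "Vector_Spaces.linear scale scale (Y r)"
proof -
  have "Y r (u + v) = Y r u + Y r v" for u v
  proof -
    obtain R where R: "\<forall>N\<ge>R. \<forall>w\<in>{u, v}. E N w = 0"
      using E_vanishes_uniformly[of "{u, v}"] by blast
    then show ?thesis
      by (subst (1 2 3) Y_eq[of R]) (simp_all add: E_simps X_simps sum.distrib)
  qed
  moreover have "Y r (scale k v) = scale k (Y r v)" for k v
  proof -
    obtain R where R: "\<forall>N\<ge>R. E N v = 0"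
      using E_vanishes by blast
    then show ?thesis
      by (subst (1 2) Y_eq[of R]) (simp_all add: E_simps X_simps scale_sum_right)
  qed
  ultimately show ?thesis
    by (simp add: linear_endo_iff)
qed

lemmas Y_simps = linear_endo_simps[OF lin_Y] linear_endo_sum[OF lin_Y]

text \<open>Coefficient form of
  \<open>(z1 - z2) Y(z1) Y(z2) = (z1 - q^2 z2) X(z1) X(z2) E E\<close>. By the quadratic relation of
  \<open>X\<close> the right side is antisymmetric in the two variables. Every large
  \<open>S\<close> is allowed, so that two instances can use the same one.\<close>

lemma Y_Y_difference:
  "\<exists>S0. \<forall>S\<ge>S0. Y (M + 1) (Y L v) - Y M (Y (L + 1) v) =
     (\<Sum>b<S. \<Sum>a<S. X (M - int a + 1) (X (L - int b) (E a (E b v)))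
        - scale (q ^ 2) (X (M - int a) (X (L - int b + 1) (E a (E b v)))))"
proof -
  obtain R where R: "\<forall>b\<ge>R. E b v = 0"
    using E_vanishes by blast
  \<comment> \<open>The vectors on which the outer \<open>Y\<close> has to be truncated. There are
    finitely many, since \<open>E b v = 0\<close> from \<open>R\<close> on.\<close>
  define W where "W = (\<lambda>b. E b v) ` {..<R} \<union> (\<lambda>b. X (L - int b) (E b v)) ` {..<R}
      \<union> (\<lambda>b. X (L - int b + 1) (E b v)) ` {..<R}"
  have "finite W"
    by (simp add: W_def)
  then obtain R' where R': "\<forall>a\<ge>R'. \<forall>w\<in>W. E a w = 0"
    using E_vanishes_uniformly by blast
  show ?thesis
  proof (intro exI[of _ "max R R'"] allI impI)
    fix S assume "S \<ge> max R R'"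
    then have Eb: "\<forall>b\<ge>S. E b v = 0" and "S \<ge> R'"
      using R by auto
    have van: "E a (E b v) = 0" "E a (X (L - int b) (E b v)) = 0" "E a (X (L - int b + 1) (E b v)) = 0"
      if "a \<ge> S" for a b
    proof -
      have "E b v = 0 \<or> {E b v, X (L - int b) (E b v), X (L - int b + 1) (E b v)} \<subseteq> W"
        using R by (cases "b < R") (simp_all add: W_def)
      moreover have "E a w = 0" if "w \<in> W" for w
        using R' \<open>S \<ge> R'\<close> \<open>a \<ge> S\<close> that by simp
      ultimately show "E a (E b v) = 0" "E a (X (L - int b) (E b v)) = 0"
        "E a (X (L - int b + 1) (E b v)) = 0"
        by (auto simp: E_simps X_simps)
    qed
    have Y_L: "Y L v = (\<Sum>b<S. X (L - int b) (E b v))"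
      "Y (L + 1) v = (\<Sum>b<S. X (L - int b + 1) (E b v))"
      using Y_eq[OF Eb, of L] Y_eq[OF Eb, of "L + 1"] by (simp_all add: algebra_simps)
    have inner: "Y (M + 1) (X (L - int b) (E b v)) - Y M (X (L - int b + 1) (E b v)) =
        (\<Sum>a<S. X (M - int a + 1) (X (L - int b) (E a (E b v)))
          - scale (q ^ 2) (X (M - int a) (X (L - int b + 1) (E a (E b v)))))" for b
    proof -
      let ?w = "E b v"
      \<comment> \<open>One further summand, which vanishes, is allowed here: after splitting off
        \<open>a = 0\<close>, the remaining indices match those of \<open>Y M\<close>.\<close>
      have "Y (M + 1) (X (L - int b) ?w) = (\<Sum>a<Suc S. X (M + 1 - int a) (E a (X (L - int b) ?w)))"
        using van by (intro Y_eq) auto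
      also have "\<dots> = X (M + 1) (X (L - int b) ?w) + (\<Sum>a<S. X (M - int a) (E (Suc a) (X (L - int b) ?w)))"
        by (subst sum.lessThan_Suc_shift) (simp add: E_0)
      finally have "Y (M + 1) (X (L - int b) ?w) - Y M (X (L - int b + 1) ?w)
          = X (M + 1) (X (L - int b) ?w) +
            (\<Sum>a<S. X (M - int a) (E (Suc a) (X (L - int b) ?w) - E a (X (L - int b + 1) ?w)))"
        using Y_eq[of S "X (L - int b + 1) ?w" M] van by (simp add: X_simps sum_subtractf)
      also have "\<dots> = X (M + 1) (X (L - int b) ?w) + (\<Sum>a<S. X (M - int a) (X (L - int b) (E (Suc a) ?w)))
          - (\<Sum>a<S. scale (q ^ 2) (X (M - int a) (X (L - int b + 1) (E a ?w))))"
        by (simp add: E_X_exchange X_simps sum_subtractf)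
      also have "X (M + 1) (X (L - int b) ?w) + (\<Sum>a<S. X (M - int a) (X (L - int b) (E (Suc a) ?w)))
          = (\<Sum>a<Suc S. X (M + 1 - int a) (X (L - int b) (E a ?w)))"
        by (subst sum.lessThan_Suc_shift) (simp add: E_0)
      also have "\<dots> = (\<Sum>a<S. X (M - int a + 1) (X (L - int b) (E a ?w)))"
        using van by (simp add: X_simps algebra_simps)
      finally show ?thesis
        by (simp add: sum_subtractf)
    qed
    have "Y (M + 1) (Y L v) - Y M (Y (L + 1) v) =
        (\<Sum>b<S. Y (M + 1) (X (L - int b) (E b v)) - Y M (X (L - int b + 1) (E b v)))"
      by (simp add: Y_L Y_simps sum_subtractf)
    then show "Y (M + 1) (Y L v) - Y M (Y (L + 1) v) =
      (\<Sum>b<S. \<Sum>a<S. X (M - int a + 1) (X (L - int b) (E a (E b v)))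
        - scale (q ^ 2) (X (M - int a) (X (L - int b + 1) (E a (E b v)))))"
      by (simp only: inner)
  qed
qed

text \<open>Multiplication by \<open>z1 - z2\<close> cannot simply be cancelled, because it
  annihilates the formal delta function. Such a multiple would have coefficients symmetric in the
  two modes, whereas a commutator is antisymmetric and 2 is invertible.\<close>

theorem Y_commute: "Y M (Y L v) = Y L (Y M v)"
proof -
  define C where "C M L = Y M (Y L v) - Y L (Y M v)" for M L
  have shift: "C (M + 1) L = C M (L + 1)" for M L
  proof -
    obtain S1 where S1: "\<And>S. S \<ge> S1 \<Longrightarrow> Y (M + 1) (Y L v) - Y M (Y (L + 1) v) =
      (\<Sum>b<S. \<Sum>a<S. X (M - int a + 1) (X (L - int b) (E a (E b v)))
        - scale (q ^ 2) (X (M - int a) (X (L - int b + 1) (E a (E b v)))))"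
      using Y_Y_difference by blast
    obtain S2 where S2: "\<And>S. S \<ge> S2 \<Longrightarrow> Y (L + 1) (Y M v) - Y L (Y (M + 1) v) =
      (\<Sum>b<S. \<Sum>a<S. X (L - int a + 1) (X (M - int b) (E a (E b v)))
        - scale (q ^ 2) (X (L - int a) (X (M - int b + 1) (E a (E b v)))))"
      using Y_Y_difference by blast
    define S where "S = max S1 S2"
    have exchange: "X (r + 1) (X s w) - scale (q ^ 2) (X r (X (s + 1) w)) =
        - (X (s + 1) (X r w) - scale (q ^ 2) (X s (X (r + 1) w)))" for r s w
      using X_X[of r s w] by (simp add: algebra_simps)
    \<comment> \<open>Exchanging the currents also exchanges the roles of \<open>a\<close> and
      \<open>b\<close>; \<open>E_E\<close> makes the exponentials follow.\<close>
    have summand: "X (M - int a + 1) (X (L - int b) (E a (E b v)))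
        - scale (q ^ 2) (X (M - int a) (X (L - int b + 1) (E a (E b v)))) =
        - (X (L - int b + 1) (X (M - int a) (E b (E a v)))
        - scale (q ^ 2) (X (L - int b) (X (M - int a + 1) (E b (E a v)))))" for a b
      using exchange[of "M - int a" "L - int b" "E a (E b v)"] by (simp only: E_E[of a b])
    have "Y (M + 1) (Y L v) - Y M (Y (L + 1) v) = - (\<Sum>b<S. \<Sum>a<S.
        X (L - int b + 1) (X (M - int a) (E b (E a v)))
        - scale (q ^ 2) (X (L - int b) (X (M - int a + 1) (E b (E a v)))))"
      by (subst S1[of S]) (simp_all only: summand sum_negf S_def max.cobounded1)
    also have "\<dots> = - (Y (L + 1) (Y M v) - Y L (Y (M + 1) v))"
      by (subst S2[of S], simp add: S_def, subst sum.swap, rule refl)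
    finally show ?thesis
      by (simp add: C_def algebra_simps)
  qed
  have shift_nat: "C (M + int j) L = C M (L + int j)" for M L j
  proof (induction j arbitrary: M L)
    case (Suc j)
    have "C (M + int (Suc j)) L = C (M + 1 + int j) L"
      by (simp add: algebra_simps)
    also have "\<dots> = C M (L + int j + 1)"
      by (simp only: Suc shift)
    finally show ?case
      by (simp add: algebra_simps)
  qed simp
  have "C M L = C L M"
    using shift_nat[of M "nat (L - M)" M] shift_nat[of L "nat (M - L)" L]
    by (cases "M \<le> L") auto
  moreover have "C L M = - C M L"
    by (simp add: C_def)
  ultimately have "C M L + C M L = 0"
    by (metis add.right_inverse)
  then have "scale 2 (C M L) = 0"
    by (metis one_add_one scale_left_distrib scale_one)
  moreover have "(2 :: qfield) \<noteq> 0"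
    using of_nat_qfield_eq_0_iff[of 2] by simp
  ultimately show ?thesis
    by (simp add: C_def)
qed

end

section \<open>The Ding-Feigin operators as dressed currents\<close>

lemma Sum_any_shifted_support:
  fixes g :: "int \<Rightarrow> 'a::comm_monoid_add"
  assumes "\<And>s. s < t \<or> t + int R \<le> s \<Longrightarrow> g s = 0"
  shows "Sum_any g = (\<Sum>N<R. g (t + int N))"
proof -
  have "s \<in> {t..<t + int R}" if "g s \<noteq> 0" for s
    using assms[of s] that by force
  then have "Sum_any g = (\<Sum>s\<in>{t..<t + int R}. g s)"
    by (intro Sum_any.expand_superset) auto
  also have "\<dots> = (\<Sum>N<R. g (t + int N))"
    by (rule sum.reindex_bij_witness[of _ "\<lambda>N. t + int N" "\<lambda>s. nat (s - t)"]) auto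
  finally show ?thesis .
qed

lemma cartan_diagonal: "n \<ge> 1 \<Longrightarrow> i \<le> n \<Longrightarrow> cartan n i i = 2"
  by (auto simp: cartan_def mod_Suc)

context integrable_highest_weight_module
begin

text \<open>The module axioms constrain \<open>a i s\<close> for nonzero \<open>s\<close> only, so
  the value at \<open>r = 0\<close> is set by hand to satisfy \<open>B 0 = 0\<close>.\<close>

definition dressing :: "nat \<Rightarrow> nat \<Rightarrow> 'a \<Rightarrow> 'a" where
  "dressing i r w = (if r = 0 then 0
     else scale (- (q - inverse q) * (qh ^ ((4 + c) * r) / (1 + q ^ (2 * r)))) (a i (int r) w))"

text \<open>This explains the constant in the exponential: its factor \<open>q^(cr/2)\<close>
  cancels the level factor of the commutator, and \<open>1 + q^(2r)\<close> divides
  \<open>q^(2r) - q^(-2r)\<close>, leaving \<open>1 - q^(2r)\<close>.\<close>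

lemma dressing_coefficient:
  assumes "r > 0"
  shows "of_nat r * (- (q - inverse q) * (qh ^ ((4 + c) * r) / (1 + q ^ (2 * r)))) *
     (qint (2 * int r) / of_int (int r) * qh powi (- (int c * \<bar>int r\<bar>))) = 1 - q ^ (2 * r)"
proof -
  define Q where "Q = q ^ (2 * r)"
  define W where "W = qh ^ (c * r)"
  define D where "D = q - inverse q"
  have nz: "Q \<noteq> 0" "W \<noteq> 0" "D \<noteq> 0" "1 + Q \<noteq> 0" "(of_nat r :: qfield) \<noteq> 0"
    using assms one_plus_q_power_nonzero q_minus_inverse_nonzero
    by (auto simp: Q_def W_def D_def of_nat_qfield_eq_0_iff)
  have 1: "qh ^ ((4 + c) * r) = Q * W"
    by (simp add: Q_def W_def q_def distrib_right power_add flip: power_mult)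
  have 2: "qh powi (- (int c * \<bar>int r\<bar>)) = 1 / W"
    by (simp add: W_def power_int_minus divide_inverse flip: of_nat_mult)
  have 3: "qint (2 * int r) = (Q - 1 / Q) / D"
    unfolding qint_def D_def Q_def power_int_minus
    by (simp add: divide_inverse power_int_def nat_mult_distrib)
  have factor: "Q - 1 / Q = (Q - 1) * (1 + Q) / Q"
    using nz by (simp add: field_simps)
  have "x * (- D * (Q * W / P)) * ((Q - 1) * P / Q / D / x * (1 / W)) = 1 - Q"
    if "P \<noteq> 0" "x \<noteq> 0" for x P
    using nz that by (simp add: field_simps)
  from this[OF nz(4,5)] have "of_nat r * (- D * (Q * W / (1 + Q))) * ((Q - 1 / Q) / D / of_nat r * (1 / W)) = 1 - Q"
    unfolding factor .
  then show ?thesis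
    unfolding 1 2 3 Q_def[symmetric] D_def[symmetric] by simp
qed

text \<open>\<open>dressing i r\<close> has degree \<open>r\<close> for \<open>q^d\<close>, hence
  \<open>E N\<close> has degree \<open>N\<close> and mode \<open>l\<close> of the current has degree
  \<open>l\<close>. \<open>large_degree_vanishes\<close> then serves twice: for finiteness of the
  exponential on a vector, and for truncation of the resulting series.\<close>

lemma
  assumes i: "i \<in> {1..n}"
  shows xbar1_dressed_current:
      "dressed_current scale (dressing i) (xp i) (\<lambda>l. xbar1 scale c (xp i) (a i) (- l - 1))"
    and xbar1_in_Eser: "xbar1 scale c (xp i) (a i) \<in> Eser scale"
proof -
  have lin_xp: "Vector_Spaces.linear scale scale (xp i l)" for l
    using i lin_drinfeld by blast
  have lin_a': "Vector_Spaces.linear scale scale (a i (int r))" if "r > 0" for r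
    using that i lin_a by simp
  have cartan: "cartan n i i = 2"
    using i rank_pos by (intro cartan_diagonal) auto
  interpret exp_operators scale "dressing i"
  proof (intro exp_operators.intro exp_operators_axioms.intro vector_space_axioms)
    show "Vector_Spaces.linear scale scale (dressing i r)" for r
      using lin_a'[of r] unfolding dressing_def linear_endo_iff
      by (simp add: scale_right_distrib mult.commute)
    show "dressing i 0 v = 0" for v
      by (simp add: dressing_def)
    have "a i (int r) (a i (int s) v) = a i (int s) (a i (int r) v)" if "r > 0" "s > 0" for r s v
      using a_a[OF i i, of "int r" "int s" v] that by simp
    then show "dressing i r (dressing i s v) = dressing i s (dressing i r v)" for r s v
      unfolding dressing_def
      by (simp add: linear_endo_simps[OF lin_a'] mult.commute)
  qed
  have qd_simps: "qd (u + v) = qd u + qd v" "qd (scale k v) = scale k (qd v)" "qd 0 = 0" for u v k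
    using linear_endo_simps[OF conjunct1[OF lin_qd]] by auto
  have qd_sum: "qd (\<Sum>j\<in>J. g j) = (\<Sum>j\<in>J. qd (g j))" for g :: "nat \<Rightarrow> 'a" and J
    by (rule linear_endo_sum[OF conjunct1[OF lin_qd]])
  have qd_dressing: "qd (dressing i r w) = scale (q ^ r) (dressing i r (qd w))" for r w
    unfolding dressing_def using qd_a[OF i, of "int r" w] by (simp add: qd_simps mult.commute)
  have qd_pow: "qd (pow_coeff (dressing i) p N w) = scale (q ^ N) (pow_coeff (dressing i) p N (qd w))" for p N w
  proof (induction p arbitrary: N)
    case (Suc p)
    show ?case
      unfolding pow_coeff_Suc qd_sum scale_sum_right
      by (intro sum.cong) (auto simp: qd_dressing Suc B_simps simp flip: power_add)
  qed (simp add: qd_simps)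
  have qd_E: "qd (E N w) = scale (q powi int N) (E N (qd w))" for N w
    by (simp add: exp_coeff_def qd_sum qd_simps qd_pow scale_sum_right mult.commute)
  have E_van: "\<exists>R. \<forall>N\<ge>R. E N v = 0" for v
  proof -
    obtain D where D: "\<forall>N>D. \<forall>T. Vector_Spaces.linear scale scale T \<longrightarrow>
        (\<forall>w. qd (T w) = scale (q powi N) (T (qd w))) \<longrightarrow> T v = 0"
      using large_degree_vanishes by blast
    have "E N v = 0" if "N \<ge> nat (D + 1)" for N
      using D[rule_format, of "int N" "E N"] that lin_E qd_E by force
    then show ?thesis
      by blast
  qed
  have Y_eq: "xbar1 scale c (xp i) (a i) (- l - 1) v = (\<Sum>N<R. xp i (l - int N) (E N v))"
    if R: "\<forall>N\<ge>R. E N v = 0" for R l v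
  proof -
    have "exp_coeff scale (\<lambda>r w. scale (- (q - inverse q) * (qh ^ ((4 + c) * r) / (1 + q ^ (2 * r))))
        (a i (int r) w)) N v = E N v" for N
      by (rule exp_coeff_cong) (simp add: dressing_def)
    then have "xbar1 scale c (xp i) (a i) (- l - 1) v =
        Sum_any (\<lambda>s. xp i (- s - 1) (if - l - 1 - s > 0 then 0 else E (nat (- (- l - 1 - s))) v))"
      by (simp only: xbar1_def ser_mult_def)
    also have "\<dots> = (\<Sum>N<R. xp i (- (- l - 1 + int N) - 1) (E N v))"
      using R by (subst Sum_any_shifted_support[of "- l - 1" R])
        (auto simp: linear_endo_simps[OF lin_xp])
    finally show ?thesis
      by (simp add: algebra_simps)
  qed
  show dressed: "dressed_current scale (dressing i) (xp i) (\<lambda>l. xbar1 scale c (xp i) (a i) (- l - 1))"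
  proof (intro dressed_current.intro dressed_current_axioms.intro)
    show "exp_operators scale (dressing i)"
      by unfold_locales
    show "scale (of_nat r) (dressing i r (xp i l v)) =
        scale (of_nat r) (xp i l (dressing i r v)) + scale (1 - q ^ (2 * r)) (xp i (l + int r) v)" for r l v
    proof (cases "r = 0")
      case False
      then have r: "r > 0" by simp
      let ?k = "- (q - inverse q) * (qh ^ ((4 + c) * r) / (1 + q ^ (2 * r)))"
      let ?k' = "qint (2 * int r) / of_int (int r) * qh powi (- (int c * \<bar>int r\<bar>))"
      have dressed: "dressing i r w = scale ?k (a i (int r) w)" for w
        using r by (simp add: dressing_def)
      have "a i (int r) (xp i l v) = xp i l (a i (int r) v) + scale ?k' (xp i (int r + l) v)"
        using a_xp[OF i i, of "int r" l v] r unfolding cartan by (simp add: algebra_simps)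
      then have "scale (of_nat r) (dressing i r (xp i l v)) = scale (of_nat r * ?k) (xp i l (a i (int r) v))
          + scale (of_nat r * ?k * ?k') (xp i (int r + l) v)"
        unfolding dressed by (simp only: scale_right_distrib scale_scale mult.assoc)
      also have "scale (of_nat r * ?k) (xp i l (a i (int r) v)) = scale (of_nat r) (xp i l (dressing i r v))"
        unfolding dressed by (simp only: linear_endo_simps[OF lin_xp] scale_scale)
      finally show ?thesis
        unfolding dressing_coefficient[OF r] by (simp add: add.commute)
    qed (simp add: dressing_def)
    show "xp i (k + 1) (xp i l v) - scale (q ^ 2) (xp i l (xp i (k + 1) v)) =
        scale (q ^ 2) (xp i k (xp i (l + 1) v)) - xp i (l + 1) (xp i k v)" for k l v
      using xp_xp[OF i i, of k l v] by (simp add: cartan)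
  qed (use lin_xp E_van Y_eq in auto)
  interpret dressed_current scale "dressing i" "xp i" "\<lambda>l. xbar1 scale c (xp i) (a i) (- l - 1)"
    by (rule dressed)
  let ?Y = "\<lambda>l. xbar1 scale c (xp i) (a i) (- l - 1)"
  have qd_Y: "qd (?Y l w) = scale (q powi l) (?Y l (qd w))" for l w
  proof -
    obtain R where R: "\<forall>N\<ge>R. \<forall>u\<in>{w, qd w}. E N u = 0"
      using E_vanishes_uniformly[of "{w, qd w}"] by blast
    have 1: "?Y l w = (\<Sum>N<R. xp i (l - int N) (E N w))"
      and 2: "?Y l (qd w) = (\<Sum>N<R. xp i (l - int N) (E N (qd w)))"
      using R by (intro Y_eq; simp)+
    show ?thesis
      unfolding 1 2 qd_sum scale_sum_right
      by (intro sum.cong) (auto simp: qd_xp[OF i] qd_E X_simps power_int_diff)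
  qed
  show "xbar1 scale c (xp i) (a i) \<in> Eser scale"
    unfolding Eser_def
  proof (intro CollectI conjI allI)
    show "Vector_Spaces.linear scale scale (xbar1 scale c (xp i) (a i) p)" for p
      using lin_Y[of "- p - 1"] by simp
    fix v
    obtain D where D: "\<forall>N>D. \<forall>T. Vector_Spaces.linear scale scale T \<longrightarrow>
        (\<forall>w. qd (T w) = scale (q powi N) (T (qd w))) \<longrightarrow> T v = 0"
      using large_degree_vanishes by blast
    \<comment> \<open>The coefficient of \<open>z^p\<close> is the mode \<open>-p-1\<close>, whose
      degree exceeds \<open>D\<close>.\<close>
    have "xbar1 scale c (xp i) (a i) p v = 0" if "p < - D - 1" for p
      using D[rule_format, of "- p - 1" "?Y (- p - 1)"] lin_Y[of "- p - 1"] qd_Y[of "- p - 1"] that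
      by simp
    then show "\<exists>n0. \<forall>p<n0. xbar1 scale c (xp i) (a i) p v = 0"
      by blast
  qed
qed

lemma xbar1_commute:
  assumes "i \<in> {1..n}"
  shows "xbar1 scale c (xp i) (a i) s (xbar1 scale c (xp i) (a i) t v) =
    xbar1 scale c (xp i) (a i) t (xbar1 scale c (xp i) (a i) s v)"
  using dressed_current.Y_commute[OF xbar1_dressed_current[OF assms], of "- s - 1" "- t - 1" v] by simp

end

section \<open>Series with commuting coefficients\<close>

lemma (in vector_space) linear_endo_Sum_any:
  assumes T: "Vector_Spaces.linear scale scale T" and "finite {s. g s \<noteq> 0}"
  shows "T (Sum_any g) = Sum_any (\<lambda>s. T (g s))"
proof -
  have "Sum_any (\<lambda>s. T (g s)) = (\<Sum>s\<in>{s. g s \<noteq> 0}. T (g s))"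
    using assms(2) by (intro Sum_any.expand_superset) (auto simp: linear_endo_simps[OF T])
  then show ?thesis
    by (simp add: Sum_any.expand_set linear_endo_sum[OF T])
qed

lemma (in vector_space) scale_Sum_any:
  assumes "finite {s. g s \<noteq> 0}"
  shows "scale k (Sum_any g) = Sum_any (\<lambda>s. scale k (g s))"
  by (rule linear_endo_Sum_any[OF _ assms]) (simp add: linear_endo_iff scale_right_distrib mult.commute)

lemma Sum_any_sum:
  assumes "\<And>j. j \<in> J \<Longrightarrow> finite {s. g j s \<noteq> 0}"
  shows "Sum_any (\<lambda>s. \<Sum>j\<in>J. g j s) = (\<Sum>j\<in>J. Sum_any (g j))"
  using assms
proof (induction J rule: infinite_finite_induct)
  case (insert j J)
  have "finite {s. (\<Sum>j\<in>J. g j s) \<noteq> 0}"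
  proof (rule finite_subset)
    show "{s. (\<Sum>j\<in>J. g j s) \<noteq> 0} \<subseteq> (\<Union>j\<in>J. {s. g j s \<noteq> 0})"
      using sum.not_neutral_contains_not_neutral by fastforce
  qed (use insert in auto)
  then show ?case
    using insert by (simp add: Sum_any.distrib)
qed simp_all

lemma Sum_any_reflect: "Sum_any (\<lambda>s. g (t - s)) = Sum_any (g :: int \<Rightarrow> 'a::comm_monoid_add)"
proof -
  have "bij (\<lambda>s. t - s)"
    by (rule o_bij[of "\<lambda>s. t - s"]) (simp_all add: fun_eq_iff)
  from Sum_any.reindex_cong[OF this refl, of g] show ?thesis
    by (simp add: comp_def)
qed

lemma Sum_any_translate: "Sum_any (\<lambda>s. g (s + t)) = Sum_any (g :: int \<Rightarrow> 'a::comm_monoid_add)"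
proof -
  have "bij (\<lambda>s. s + t)"
    by (rule o_bij[of "\<lambda>s. s - t"]) (simp_all add: fun_eq_iff)
  from Sum_any.reindex_cong[OF this refl, of g] show ?thesis
    by (simp add: comp_def)
qed

text \<open>Factor \<open>i\<close> is \<open>[n + l - i]\<close>. It is written through
  \<open>p^(n+l)\<close>, the power belonging to the exponent before differentiation, so that the
  product is a polynomial in that power.\<close>

lemma qderiv_power_eq:
  fixes scale :: "qfield \<Rightarrow> 'v::ab_group_add \<Rightarrow> 'v"
  assumes "vector_space scale"
  shows "(qderiv scale ^^ l) b n v =
     scale (\<Prod>i<l. (qq powi (n + int l) * inverse qq ^ i - 1) / (qq - 1)) (b (n + int l) v)"
proof -
  interpret vector_space scale
    by fact
  have qderiv: "qderiv scale g n v = scale ((qq powi (n + 1) - 1) / (qq - 1)) (g (n + 1) v)" for g n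
    by (simp add: qderiv_def zshift_def dil_def scale_right_diff_distrib diff_divide_distrib
        scale_left_diff_distrib)
  show ?thesis
  proof (induction l arbitrary: n)
    case (Suc l)
    have "qq powi (n + 1 + int l) * inverse qq ^ l = qq powi (n + 1)"
      by (simp add: power_int_add power_inverse field_simps)
    moreover have "n + int (Suc l) = n + 1 + int l"
      by simp
    ultimately show ?case
      by (simp only: funpow.simps comp_apply qderiv Suc scale_scale prod.lessThan_Suc mult.commute)
  qed simp
qed

locale commuting_current = vector_space scale
  for scale :: "qfield \<Rightarrow> 'v::ab_group_add \<Rightarrow> 'v" +
  fixes Y :: "'v ser" and x :: "nat \<Rightarrow> 'v ser"
  assumes Y_in_Eser: "Y \<in> Eser scale"
    and Y_commute: "Y s (Y t v) = Y t (Y s v)"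
    and x_0: "x 0 = ser_one"
    and x_Suc: "x (Suc m) = ser_mult Y (dil scale 1 (x m))"
begin

definition commutant :: "('v \<Rightarrow> 'v) set" where
  "commutant = {T. Vector_Spaces.linear scale scale T \<and> (\<forall>s v. T (Y s v) = Y s (T v))}"

text \<open>The coefficients of these series lie in the bicommutant of the coefficients of \<open>Y\<close>, which is a
  commutative algebra because \<open>Y\<close> has commuting coefficients.\<close>

definition bicommutant_series :: "'v ser set" where
  "bicommutant_series = {b \<in> Eser scale. \<forall>n. \<forall>T\<in>commutant. \<forall>v. b n (T v) = T (b n v)}"

lemma bicommutant_linear: "b \<in> bicommutant_series \<Longrightarrow> Vector_Spaces.linear scale scale (b n)"
  by (simp add: bicommutant_series_def Eser_def)

lemmas bicommutant_simps = linear_endo_simps[OF bicommutant_linear]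

lemma Y_in_commutant: "Y s \<in> commutant"
  using Y_in_Eser Y_commute by (simp add: commutant_def Eser_def)

text \<open>Each \<open>Y s\<close> lies in the commutant, so \<open>b s\<close> commutes with
  \<open>Y\<close> and lies there as well; \<open>d t\<close> commutes with the whole
  commutant.\<close>

lemma bicommutant_commute:
  assumes "b \<in> bicommutant_series" "d \<in> bicommutant_series"
  shows "b s (d t v) = d t (b s v)"
proof -
  have "b s \<in> commutant"
    using assms(1) Y_in_commutant bicommutant_linear[OF assms(1)]
    unfolding commutant_def bicommutant_series_def by auto
  then show ?thesis
    using assms(2) by (simp add: bicommutant_series_def)
qed

lemma bicommutant_truncated:
  assumes "b \<in> bicommutant_series"
  obtains n0 where "\<And>s. s < n0 \<Longrightarrow> b s v = 0"
  using assms unfolding bicommutant_series_def Eser_def by blast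

text \<open>The bound on the inner exponent is truncation of \<open>d\<close>; the bound on the
  outer one is truncation of \<open>b\<close> after the two operators are exchanged.\<close>

lemma bicommutant_compatible:
  assumes "b \<in> bicommutant_series" "d \<in> bicommutant_series"
  obtains n0 where "\<And>s t. s < n0 \<or> t < n0 \<Longrightarrow> b s (d t v) = 0"
proof -
  obtain n1 n2 where n: "\<And>s. s < n1 \<Longrightarrow> b s v = 0" "\<And>s. s < n2 \<Longrightarrow> d s v = 0"
    using bicommutant_truncated assms by metis
  have "b s (d t v) = 0" if "s < min n1 n2 \<or> t < min n1 n2" for s t
    using that n bicommutant_commute[OF assms, of s t v] assms by (auto simp: bicommutant_simps)
  then show thesis
    by (rule that)
qed

lemma compatible_bicommutant:
  "b \<in> bicommutant_series \<Longrightarrow> d \<in> bicommutant_series \<Longrightarrow> compatible b d"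
  unfolding compatible_def by (metis bicommutant_compatible)

lemma finite_support:
  assumes "b \<in> bicommutant_series" "d \<in> bicommutant_series"
  shows "finite {s. b s (d (t - s) v) \<noteq> 0}"
proof -
  obtain n0 where n0: "\<And>s t. s < n0 \<or> t < n0 \<Longrightarrow> b s (d t v) = 0"
    using bicommutant_compatible[OF assms] by metis
  have "s \<in> {n0..t - n0}" if "b s (d (t - s) v) \<noteq> 0" for s
    using n0[of s "t - s"] that by force
  then have "{s. b s (d (t - s) v) \<noteq> 0} \<subseteq> {n0..t - n0}"
    by auto
  then show ?thesis
    by (rule finite_subset) simp
qed

lemma Y_bicommutant: "Y \<in> bicommutant_series"
  using Y_in_Eser by (simp add: bicommutant_series_def commutant_def)

lemma one_bicommutant: "ser_one \<in> bicommutant_series"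
proof -
  have "\<exists>n0. \<forall>n<n0. ser_one n v = 0" for v :: 'v
    by (intro exI[of _ 0]) (simp add: ser_one_def)
  moreover have "T 0 = 0" if "T \<in> commutant" for T
    using that linear_endo_simps(5)[of T] by (simp add: commutant_def)
  ultimately show ?thesis
    by (simp add: bicommutant_series_def Eser_def ser_one_def linear_endo_iff)
qed

lemma dil_bicommutant:
  assumes "b \<in> bicommutant_series"
  shows "dil scale l b \<in> bicommutant_series"
proof -
  have "\<exists>n0. \<forall>n<n0. dil scale l b n v = 0" for v
    using bicommutant_truncated[OF assms, of v] by (metis dil_def scale_zero_right)
  then show ?thesis
    using assms
    by (auto simp: bicommutant_series_def Eser_def dil_def linear_endo_iff scale_right_distrib
        mult.commute commutant_def)
qed

text \<open>A bicommutant is closed under sums that are finite only vector by vector, unlike, in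
  general, the algebra generated by the coefficients of \<open>Y\<close>.\<close>

lemma mult_bicommutant:
  assumes "b \<in> bicommutant_series" "d \<in> bicommutant_series"
  shows "ser_mult b d \<in> bicommutant_series"
proof -
  note fin = finite_support[OF assms]
  have "Vector_Spaces.linear scale scale (ser_mult b d n)" for n
    unfolding linear_endo_iff ser_mult_def
    by (simp add: bicommutant_simps assms scale_Sum_any[OF fin] Sum_any.distrib[OF fin fin])
  moreover have "\<exists>n0. \<forall>n<n0. ser_mult b d n v = 0" for v
  proof -
    obtain n0 where n0: "\<And>s t. s < n0 \<or> t < n0 \<Longrightarrow> b s (d t v) = 0"
      using bicommutant_compatible[OF assms] by metis
    have "b s (d (n - s) v) = 0" if "n < 2 * n0" for n s
      using that n0[of s "n - s"] by force
    then show ?thesis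
      by (intro exI[of _ "2 * n0"]) (simp add: ser_mult_def)
  qed
  moreover have "ser_mult b d n (T v) = T (ser_mult b d n v)" if "T \<in> commutant" for n T v
  proof -
    have "b s (d t (T v)) = T (b s (d t v))" for s t
      using assms that by (simp add: bicommutant_series_def)
    moreover have "Vector_Spaces.linear scale scale T"
      using that by (simp add: commutant_def)
    ultimately show ?thesis
      unfolding ser_mult_def by (simp add: linear_endo_Sum_any[OF _ fin])
  qed
  ultimately show ?thesis
    by (simp add: bicommutant_series_def Eser_def)
qed

lemma mult_commute:
  assumes "b \<in> bicommutant_series" "d \<in> bicommutant_series"
  shows "ser_mult b d = ser_mult d b"
proof (intro ext)
  fix n v
  have "ser_mult b d n v = Sum_any (\<lambda>s. d (n - s) (b (n - (n - s)) v))"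
    unfolding ser_mult_def by (simp add: bicommutant_commute[OF assms])
  also have "\<dots> = ser_mult d b n v"
    unfolding ser_mult_def by (rule Sum_any_reflect)
  finally show "ser_mult b d n v = ser_mult d b n v" .
qed

lemma mult_assoc:
  assumes "b \<in> bicommutant_series" "d \<in> bicommutant_series" "g \<in> bicommutant_series"
  shows "ser_mult (ser_mult b d) g = ser_mult b (ser_mult d g)"
proof (intro ext)
  fix n v
  define F where "F t u = b t (d u (g (n - t - u) v))" for t u
  obtain n1 n2 n3 where n: "\<And>s. s < n1 \<Longrightarrow> b s v = 0" "\<And>s. s < n2 \<Longrightarrow> d s v = 0" "\<And>s. s < n3 \<Longrightarrow> g s v = 0"
    using bicommutant_truncated assms by metis
  define n0 where "n0 = min n1 (min n2 n3)"
  \<comment> \<open>Any of the three factors can be made to act on \<open>v\<close> first, so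
    truncation of a single one suffices. The nonzero terms then lie in a finite region, and the sums
    may be exchanged.\<close>
  have F0: "F t u = 0" if "t < n0 \<or> u < n0 \<or> n - t - u < n0" for t u
  proof -
    have "F t u = d u (g (n - t - u) (b t v))" "F t u = b t (g (n - t - u) (d u v))"
      by (simp_all add: F_def bicommutant_commute assms)
    moreover have "b t v = 0 \<or> d u v = 0 \<or> g (n - t - u) v = 0"
      using that n by (auto simp: n0_def)
    ultimately show ?thesis
      by (auto simp: F_def bicommutant_simps assms)
  qed
  have "ser_mult (ser_mult b d) g n v = Sum_any (\<lambda>s. Sum_any (\<lambda>t. F t (s - t)))"
    by (simp add: ser_mult_def F_def)
  also have "\<dots> = Sum_any (\<lambda>t. Sum_any (\<lambda>s. F t (s - t)))"
  proof (rule Sum_any.swap)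
    have "s \<in> {2 * n0..n - n0}" "t \<in> {n0..n - 2 * n0}" if "F t (s - t) \<noteq> 0" for s t
      using F0[of t "s - t"] that by force+
    then show "{s. \<exists>t. F t (s - t) \<noteq> 0} \<times> {t. \<exists>s. F t (s - t) \<noteq> 0}
        \<subseteq> {2 * n0..n - n0} \<times> {n0..n - 2 * n0}"
      by blast
  qed simp
  also have "\<dots> = Sum_any (\<lambda>t. Sum_any (F t))"
  proof (rule Sum_any.cong)
    show "Sum_any (\<lambda>s. F t (s - t)) = Sum_any (F t)" for t
      using Sum_any_translate[of "F t" "- t"] by simp
  qed
  also have "\<dots> = ser_mult b (ser_mult d g) n v"
    unfolding ser_mult_def F_def
    by (simp add: linear_endo_Sum_any[OF bicommutant_linear finite_support] assms)
  finally show "ser_mult (ser_mult b d) g n v = ser_mult b (ser_mult d g) n v" .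
qed

lemma dil_mult:
  assumes "b \<in> bicommutant_series" "d \<in> bicommutant_series"
  shows "dil scale l (ser_mult b d) = ser_mult (dil scale l b) (dil scale l d)"
proof (intro ext)
  fix n v
  have "scale ((qq ^ l) powi n) (b s (d (n - s) v)) = dil scale l b s (dil scale l d (n - s) v)" for s
    using assms by (simp add: dil_def bicommutant_simps flip: power_int_add)
  moreover have "dil scale l (ser_mult b d) n v =
      Sum_any (\<lambda>s. scale ((qq ^ l) powi n) (b s (d (n - s) v)))"
    using scale_Sum_any[OF finite_support[OF assms]] by (simp only: dil_def ser_mult_def)
  ultimately show "dil scale l (ser_mult b d) n v = ser_mult (dil scale l b) (dil scale l d) n v"
    by (simp only: ser_mult_def)
qed

lemma dil_dil: "dil scale l (dil scale l' b) = dil scale (l + l') b"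
  by (intro ext) (simp add: dil_def power_add power_int_mult_distrib)

lemma dil_0: "dil scale 0 b = b"
  by (intro ext) (simp add: dil_def)

lemma dil_one: "dil scale l ser_one = ser_one"
  by (intro ext) (simp add: dil_def ser_one_def)

lemma one_mult: "ser_mult ser_one b = b"
  by (intro ext) (simp add: ser_mult_def ser_one_def)

lemma x_bicommutant: "x m \<in> bicommutant_series"
  by (induction m) (simp_all add: x_0 x_Suc one_bicommutant mult_bicommutant Y_bicommutant dil_bicommutant)

lemma x_add: "x (r + s) = ser_mult (x r) (dil scale r (x s))"
proof (induction r)
  case 0
  then show ?case by (simp add: x_0 one_mult dil_0)
next
  case (Suc r)
  then show ?case
    by (simp add: x_Suc dil_mult dil_dil mult_assoc x_bicommutant dil_bicommutant Y_bicommutant)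
qed

text \<open>The first \<open>j\<close> factors of one string end where the other string begins, so
  they can be handed over to it.\<close>

lemma x_overlap:
  "ser_mult (dil scale u (x (j + r))) (dil scale (u + j) (x s)) =
    ser_mult (dil scale (u + j) (x r)) (dil scale u (x (j + s)))"
proof -
  have "ser_mult (dil scale u (x (j + r))) (dil scale (u + j) (x s)) =
      ser_mult (ser_mult (dil scale u (x j)) (dil scale (u + j) (x r))) (dil scale (u + j) (x s))"
    by (simp add: x_add dil_mult dil_dil x_bicommutant dil_bicommutant)
  also have "\<dots> = ser_mult (ser_mult (dil scale (u + j) (x r)) (dil scale u (x j))) (dil scale (u + j) (x s))"
    by (simp add: mult_commute x_bicommutant dil_bicommutant)
  also have "\<dots> = ser_mult (dil scale (u + j) (x r)) (dil scale u (x (j + s)))"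
    by (simp add: mult_assoc x_add dil_mult dil_dil x_bicommutant dil_bicommutant)
  finally show ?thesis .
qed

end

section \<open>Products of strings\<close>

context commuting_current
begin

lemma dil_mult_coefficient:
  assumes "b \<in> bicommutant_series" "d \<in> bicommutant_series"
  shows "ser_mult (dil scale r b) (dil scale r' d) n v =
    Sum_any (\<lambda>s. scale ((qq ^ r) powi s * (qq ^ r') powi (n - s)) (b s (d (n - s) v)))"
  unfolding ser_mult_def dil_def by (simp add: bicommutant_simps assms)

lemma finite_support_scale:
  assumes "b \<in> bicommutant_series" "d \<in> bicommutant_series"
  shows "finite {s. scale (\<kappa> s) (b s (d (t - s) v)) \<noteq> 0}"
  by (rule finite_subset[OF _ finite_support[OF assms, of t v]]) auto

text \<open>Summing over the exponent of \<open>b\<close> before differentiation turns the weight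
  into a polynomial in \<open>p^s\<close>.\<close>

lemma qprod_coefficient:
  assumes "b \<in> bicommutant_series" "d \<in> bicommutant_series"
  shows "qprod scale b (- int l - 1) d n v = Sum_any (\<lambda>s. scale
    (poly (qder_poly l) (qq powi s) * (qq ^ l) powi (n + int l - s)) (b s (d (n + int l - s) v)))"
proof -
  let ?P = "\<lambda>s. \<Prod>i<l. (qq powi s * inverse qq ^ i - 1) / (qq - 1)"
  have "finite {s. scale (?P (s + int l) * (qq ^ l) powi (n - s)) (b (s + int l) (d (n - s) v)) \<noteq> 0}"
  proof (rule finite_subset)
    show "{s. scale (?P (s + int l) * (qq ^ l) powi (n - s)) (b (s + int l) (d (n - s) v)) \<noteq> 0}
        \<subseteq> (\<lambda>s. s - int l) ` {s. b s (d (n + int l - s) v) \<noteq> 0}"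
      by (auto intro!: image_eqI[of _ _ "_ + int l"])
  qed (simp add: finite_support assms)
  then have "qprod scale b (- int l - 1) d n v = Sum_any (\<lambda>s. scale (1 / qqfact l)
      (scale (?P (s + int l) * (qq ^ l) powi (n - s)) (b (s + int l) (d (n - s) v))))"
    unfolding qprod_def ser_scale_def ser_mult_def dil_def
    by (simp add: scale_Sum_any qderiv_power_eq[OF vector_space_axioms] bicommutant_simps assms mult.commute)
  also have "\<dots> = Sum_any (\<lambda>s. scale (poly (qder_poly l) (qq powi (s + int l)) *
      (qq ^ l) powi (n + int l - (s + int l))) (b (s + int l) (d (n + int l - (s + int l)) v)))"
    by (simp add: poly_qder_poly)
  also have "\<dots> = Sum_any (\<lambda>s. scale
      (poly (qder_poly l) (qq powi s) * (qq ^ l) powi (n + int l - s)) (b s (d (n + int l - s) v)))"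
    by (rule Sum_any_translate)
  finally show ?thesis .
qed

text \<open>A monomial \<open>u^j\<close> evaluated at \<open>u = p^s\<close> is the dilation by
  \<open>p^j\<close>, so the expansion of \<open>qder_poly\<close> in monomials is the expansion of
  the derivative in dilations.\<close>

lemma qprod_expansion:
  assumes "b \<in> bicommutant_series" "d \<in> bicommutant_series"
  shows "qprod scale b (- int l - 1) d = zshift l (\<lambda>n v. \<Sum>j\<le>l.
    scale (coeff (qder_poly l) (l - j)) (ser_mult (dil scale (l - j) b) (dil scale l d) n v))"
proof (intro ext)
  fix n v
  let ?N = "n + int l"
  let ?t = "\<lambda>j s. scale ((qq ^ j) powi s * (qq ^ l) powi (?N - s)) (b s (d (?N - s) v))"
  have fin: "finite {s. ?t j s \<noteq> 0}" "finite {s. scale k (?t j s) \<noteq> 0}" for j k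
    using finite_support_scale[OF assms] finite_support[OF assms] by simp_all
  have "poly (qder_poly l) (qq powi s) = (\<Sum>j\<le>l. coeff (qder_poly l) j * (qq ^ j) powi s)" for s
    unfolding poly_altdef degree_qder_poly
    by (simp add: power_int_power power_int_power' mult.commute)
  then have "qprod scale b (- int l - 1) d n v =
      Sum_any (\<lambda>s. \<Sum>j\<le>l. scale (coeff (qder_poly l) j) (?t j s))"
    by (simp add: qprod_coefficient[OF assms] sum_distrib_right scale_sum_left mult.assoc)
  also have "\<dots> = (\<Sum>j\<le>l. scale (coeff (qder_poly l) j) (ser_mult (dil scale j b) (dil scale l d) ?N v))"
    unfolding dil_mult_coefficient[OF assms]
    by (subst Sum_any_sum[OF fin(2)]) (simp only: scale_Sum_any[OF fin(1)])
  also have "\<dots> = (\<Sum>j\<le>l. scale (coeff (qder_poly l) (l - j)) (ser_mult (dil scale (l - j) b) (dil scale l d) ?N v))"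
    by (rule sum.reindex_bij_witness[of _ "\<lambda>j. l - j" "\<lambda>j. l - j"]) auto
  finally show "qprod scale b (- int l - 1) d n v = zshift l (\<lambda>n v. \<Sum>j\<le>l.
      scale (coeff (qder_poly l) (l - j)) (ser_mult (dil scale (l - j) b) (dil scale l d) n v)) n v"
    by (simp add: zshift_def)
qed

text \<open>\<open>dil (l - j) (x m)\<close> starts \<open>j + 1\<close> places before
  \<open>dil (l + 1) (x k)\<close>; these \<open>j + 1\<close> factors change over by
  \<open>x_overlap\<close>.\<close>

lemma qprod_x_left:
  assumes "l < m"
  shows "qprod scale (x m) (- int l - 1) (dil scale 1 (x k)) = zshift l (\<lambda>n v. \<Sum>j\<le>l.
    scale (coeff (qder_poly l) (l - j))
      (ser_mult (dil scale (l + 1) (x (m - 1 - j))) (dil scale (l - j) (x (k + 1 + j))) n v))"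
proof -
  have "ser_mult (dil scale (l - j) (x m)) (dil scale l (dil scale 1 (x k))) =
      ser_mult (dil scale (l + 1) (x (m - 1 - j))) (dil scale (l - j) (x (k + 1 + j)))" if "j \<le> l" for j
    using x_overlap[of "l - j" "j + 1" "m - 1 - j" k] that assms by (simp add: dil_dil add.commute)
  then show ?thesis
    by (simp add: qprod_expansion x_bicommutant dil_bicommutant)
qed

text \<open>\<open>dil l (x k)\<close> stops just before place \<open>l + k\<close>, where the last
  \<open>m - j\<close> factors of the other string begin; joined, they form a string of length
  \<open>m + k - j\<close>.\<close>

lemma qprod_x_right:
  assumes "l < m"
  shows "qprod scale (dil scale k (x m)) (- int l - 1) (x k) = zshift l (\<lambda>n v. \<Sum>j\<le>l.
    scale (coeff (qder_poly l) (l - j))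
      (ser_mult (dil scale (k + l - j) (x j)) (dil scale l (x (m + k - j))) n v))"
proof -
  have "ser_mult (dil scale (l - j) (dil scale k (x m))) (dil scale l (x k)) =
      ser_mult (dil scale (k + l - j) (x j)) (dil scale l (x (m + k - j)))" if "j \<le> l" for j
  proof -
    have "ser_mult (dil scale (k + l - j) (x m)) (dil scale l (x k)) =
      ser_mult (ser_mult (dil scale (k + l - j) (x j)) (dil scale (l + k) (x (m - j)))) (dil scale l (x k))"
      using x_add[of j "m - j"] that assms by (simp add: dil_mult dil_dil x_bicommutant dil_bicommutant add.commute)
    also have "\<dots> = ser_mult (dil scale (k + l - j) (x j))
        (ser_mult (dil scale l (x k)) (dil scale (l + k) (x (m - j))))"
      by (simp add: mult_assoc mult_commute[of "dil scale l (x k)"] x_bicommutant dil_bicommutant)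
    also have "ser_mult (dil scale l (x k)) (dil scale (l + k) (x (m - j))) = dil scale l (x (m + k - j))"
      using x_add[of k "m - j"] that assms by (simp add: dil_mult dil_dil x_bicommutant dil_bicommutant add.commute)
    finally show ?thesis
      using that by (simp add: dil_dil add.commute)
  qed
  then show ?thesis
    by (simp add: qprod_expansion x_bicommutant dil_bicommutant)
qed

text \<open>The product of index -1 is the plain product of series, so a string is built from the
  generators factor by factor.\<close>

lemma dil_x_generated: "dil scale l (x m) \<in> qva_generated scale {dil scale l Y |l. True}"
proof (induction m arbitrary: l)
  case 0
  show ?case
    by (simp add: x_0 dil_one qva_generated.one)
next
  case (Suc m)
  have "dil scale l Y \<in> qva_generated scale {dil scale l Y |l. True}"
    using dil_bicommutant[OF Y_bicommutant]
    by (intro qva_generated.base) (auto simp: bicommutant_series_def)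
  then have "qprod scale (dil scale l Y) (- 1) (dil scale (l + 1) (x m)) \<in> qva_generated scale {dil scale l Y |l. True}"
    using Suc compatible_bicommutant dil_bicommutant Y_bicommutant x_bicommutant
    by (intro qva_generated.prod) auto
  moreover have "qprod scale (dil scale l Y) (- 1) (dil scale (l + 1) (x m)) = dil scale l (x (Suc m))"
    by (intro ext)
       (simp add: qprod_def ser_scale_def qqfact_def x_Suc dil_mult dil_dil dil_0 Y_bicommutant x_bicommutant
          dil_bicommutant)
  ultimately show ?case
    by simp
qed

lemma qprod_x_generated:
  "qprod scale (dil scale r (x m)) t (dil scale s (x k)) \<in> qva_generated scale {dil scale l Y |l. True}"
  by (intro qva_generated.prod dil_x_generated compatible_bicommutant dil_bicommutant x_bicommutant)

end

section \<open>The linear relations\<close>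

lemma vector_space_qfield: "vector_space ((*) :: qfield \<Rightarrow> qfield \<Rightarrow> qfield)"
  by unfold_locales (simp_all add: algebra_simps)

lemma ser_mult_monomial:
  fixes b d :: "qfield ser"
  assumes "\<And>s y. b s y = (if s = \<sigma> then \<kappa> * y else 0)"
  shows "ser_mult b d n y = \<kappa> * d (n - \<sigma>) y"
  by (simp add: ser_mult_def assms)

lemma dil_zmono: "dil (*) l (zmono \<sigma>) s y = (if s = \<sigma> then (qq ^ l) powi \<sigma> * y else 0)"
  by (simp add: dil_def zmono_def)

lemma ser_mult_zmono:
  "ser_mult (dil (*) r (zmono \<sigma>)) (dil (*) r' (zmono \<tau>)) (\<sigma> + \<tau>) 1 = (qq ^ r) powi \<sigma> * (qq ^ r') powi \<tau>"
  by (subst ser_mult_monomial[OF dil_zmono]) (simp add: dil_zmono)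

lemma qprod_zmono:
  "qprod (*) (dil (*) r (zmono \<sigma>)) (- int l - 1) (dil (*) r' (zmono \<tau>)) (\<sigma> + \<tau> - int l) 1 =
     poly (qder_poly l) (qq powi \<sigma>) * (qq ^ r) powi \<sigma> * (qq ^ (l + r')) powi \<tau>"
proof -
  have "(qderiv (*) ^^ l) (dil (*) r (zmono \<sigma>)) s y = (if s = \<sigma> - int l
      then ((\<Prod>i<l. (qq powi \<sigma> * inverse qq ^ i - 1) / (qq - 1)) * (qq ^ r) powi \<sigma>) * y else 0)" for s y
    by (auto simp: qderiv_power_eq[OF vector_space_qfield] dil_zmono)
  from ser_mult_monomial[OF this] show ?thesis
    by (simp add: qprod_def ser_scale_def poly_qder_poly dil_zmono dil_def[of _ l "dil _ _ _"]
        power_add power_int_mult_distrib)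
qed

lemma rel1_top:
  assumes "l < m"
  shows "rel1 \<kappa> m k N l m t =
    poly (qder_poly l) (qq powi (- t - int m)) * (qq ^ (l + 1)) powi (t - N - int k)"
proof -
  have "dil (*) 0 (zmono (- t - int m)) = zmono (- t - int m)"
    by (intro ext) (simp add: dil_def)
  moreover have "- N - int m - int k - int l = (- t - int m) + (t - N - int k) - int l"
    by simp
  moreover have "mono_of m t = zmono (- t - int m)" "mono_of (m + k - m) (N - t) = zmono (t - N - int k)"
    by (simp_all add: mono_of_def)
  \<comment> \<open>No term on the right contributes to the top row; \<open>m > 0\<close> rules out
    an accident of truncated subtraction.\<close>
  moreover have "m \<noteq> m - 1 - j" for j
    using assms by linarith
  ultimately show ?thesis
    using qprod_zmono[of 0 "- t - int m" l 1 "t - N - int k"]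
    by (simp only: rel1_def Let_def if_True if_False simp_thms) simp
qed

lemma rel2_top:
  assumes "l < m"
  shows "rel2 \<kappa> m k N l m t = poly (qder_poly l) (qq powi (- t - int m)) *
    (qq ^ k) powi (- t - int m) * (qq ^ l) powi (t - N - int k)"
proof -
  have "dil (*) 0 (zmono (t - N - int k)) = zmono (t - N - int k)"
    by (intro ext) (simp add: dil_def)
  moreover have "- N - int m - int k - int l = (- t - int m) + (t - N - int k) - int l"
    by simp
  moreover have "mono_of m t = zmono (- t - int m)" "mono_of (m + k - m) (N - t) = zmono (t - N - int k)"
    by (simp_all add: mono_of_def)
  moreover have "(\<Sum>j\<le>l. if m = j then g j else 0) = 0" for g :: "nat \<Rightarrow> qfield"
    using assms by (intro sum.neutral) auto
  ultimately show ?thesis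
    using qprod_zmono[of k "- t - int m" l 0 "t - N - int k"]
    by (simp only: rel2_def Let_def if_True add_0_right simp_thms) simp
qed

lemma mode_product_scalar:
  assumes "m' \<le> m + k"
  shows "zshift l (ser_mult (dil (*) r (mono_of m' t)) (dil (*) r' (mono_of (m + k - m') (N - t))))
    (- N - int m - int k - int l) 1 =
    (qq ^ r) powi (- t - int m') * (qq ^ r') powi (t - N - int (m + k - m'))"
proof -
  have "- N - int m - int k - int l + int l = (- t - int m') + (t - N - int (m + k - m'))"
    using assms by (simp add: of_nat_diff)
  with ser_mult_zmono[of r "- t - int m'" r' "t - N - int (m + k - m')"] show ?thesis
    by (simp add: zshift_def mono_of_def algebra_simps)
qed

lemma rel1_lower:
  assumes "m' < m"
  shows "rel1 \<kappa> m k N l m' t = - (\<Sum>j\<le>l. if m' = m - 1 - j then \<kappa> l j *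
    ((qq ^ (l + 1)) powi (- t - int m') * (qq ^ (l - j)) powi (t - N - int (m + k - m'))) else 0)"
  using assms by (simp add: rel1_def Let_def mode_product_scalar cong: if_cong)

lemma rel2_lower:
  assumes "m' < m"
  shows "rel2 \<kappa> m k N l m' t = - (\<Sum>j\<le>l. if m' = j then \<kappa> l j *
    ((qq ^ (k + l - j)) powi (- t - int m') * (qq ^ l) powi (t - N - int (m + k - m'))) else 0)"
  using assms by (simp add: rel2_def Let_def mode_product_scalar cong: if_cong)

lemma sum_lessThan_add:
  fixes g :: "nat \<Rightarrow> 'a::comm_monoid_add"
  shows "(\<Sum>j<m + n. g j) = (\<Sum>j<m. g j) + (\<Sum>j<n. g (m + j))"
  by (induction n) (simp_all add: add.assoc)

text \<open>As functions of \<open>w = p\<^sup>t\<close>, \<open>p = q\<^sup>2\<close>, the coefficients of the \<open>t\<close>-th vector in the \<open>2m\<close> relations span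
  \<open>w, \<dots>, w\<^sup>m, w\<^bsup>-k\<^esup>, \<dots>, w\<^bsup>m-1-k\<^esup>\<close>.  Evaluation at the geometric sequence \<open>t = r, r + 1, \<dots>\<close> turns these
  monomials into the rows of a Vandermonde matrix with nodes \<open>p\<^sup>e\<close>, where \<open>e\<close> runs over the exponents.\<close>

lemma window_solvable:
  assumes "m \<le> k" "h < 2 * m"
  shows "\<exists>Q1 Q2 :: qfield poly. (Q1 = 0 \<or> degree Q1 < m) \<and> (Q2 = 0 \<or> degree Q2 < m) \<and>
    (\<forall>g<2 * m. let w = qq powi (r + int g) in
       w * poly Q1 w + w powi (- int k) * poly Q2 w = (if g = h then 1 else 0))"
proof -
  \<comment> \<open>The exponents 1, ..., m followed by -k, ..., m-1-k. The second block is negative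
    because \<open>m <= k\<close>, so all nodes are distinct.\<close>
  define e where "e j = (if j < m then int j + 1 else int j - int m - int k)" for j
  have "inj_on (\<lambda>j. qq powi e j) {..<2 * m}"
    using assms(1) by (auto simp: inj_on_def qq_powi_inject e_def split: if_splits)
  then obtain \<alpha> where \<alpha>: "\<And>g. g < 2 * m \<Longrightarrow>
      (\<Sum>j<2 * m. \<alpha> j * (qq powi e j) ^ g) = (if g = h then 1 else 0)"
    using vandermonde_dual_solution[OF _ assms(2)] by blast
  \<comment> \<open>The dual solution belongs to a window starting at 0; this division moves the
    start to \<open>r\<close>.\<close>
  define \<beta> where "\<beta> j = \<alpha> j / qq powi (e j * r)" for j
  define Q where "Q s = (\<Sum>j<m. monom (\<beta> (s + j)) j)" for s
  have poly_Q: "poly (Q s) w = (\<Sum>j<m. \<beta> (s + j) * w ^ j)" for s w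
    by (simp add: Q_def poly_sum poly_monom)
  have degree_Q: "Q s = 0 \<or> degree (Q s) < m" for s
  proof (cases "m = 0")
    case False
    have "degree (Q s) < m"
      unfolding Q_def using False
      by (intro degree_sum_less) (auto intro: le_less_trans[OF degree_monom_le])
    then show ?thesis ..
  qed (simp add: Q_def)
  have "w * poly (Q 0) w + w powi (- int k) * poly (Q m) w = (if g = h then 1 else 0)"
    if g: "g < 2 * m" and w: "w = qq powi (r + int g)" for g w
  proof -
    have "w \<noteq> 0"
      by (simp add: w)
    have "\<alpha> j * (qq powi e j) ^ g = \<beta> j * w powi e j" for j
    proof -
      have "w powi e j = qq powi (e j * r) * (qq powi e j) ^ g"
        by (simp add: w power_int_power' algebra_simps flip: power_int_mult power_int_add)
      then show ?thesis
        by (simp add: \<beta>_def)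
    qed
    then have "(if g = h then 1 else 0) = (\<Sum>j<m + m. \<beta> j * w powi e j)"
      using \<alpha>[OF g] by (simp add: mult_2)
    also have "\<dots> = (\<Sum>j<m. \<beta> j * (w * w ^ j)) + (\<Sum>j<m. \<beta> (m + j) * (w powi (- int k) * w ^ j))"
      unfolding sum_lessThan_add
    proof (intro arg_cong2[where f = "(+)"] sum.cong refl)
      fix j assume "j \<in> {..<m}"
      then have e: "e j = int (Suc j)" "e (m + j) = - int k + int j"
        by (simp_all add: e_def)
      show "\<beta> j * w powi e j = \<beta> j * (w * w ^ j)"
        unfolding e power_int_of_nat by simp
      show "\<beta> (m + j) * w powi e (m + j) = \<beta> (m + j) * (w powi (- int k) * w ^ j)"
        unfolding e using \<open>w \<noteq> 0\<close> by (subst power_int_add) simp_all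
    qed
    also have "\<dots> = w * poly (Q 0) w + w powi (- int k) * poly (Q m) w"
      by (simp add: poly_Q sum_distrib_left mult.left_commute)
    finally show ?thesis ..
  qed
  with degree_Q show ?thesis
    unfolding Let_def by blast
qed

text \<open>Up to scalars, the Newton basis for the nodes \<open>p^(-m), p^(-m-1), ...\<close>. It
  is the common factor of the top rows of both families once negative powers of
  \<open>w = p^t\<close> are cleared.\<close>

definition newton_poly :: "nat \<Rightarrow> nat \<Rightarrow> qfield poly" where
  "newton_poly m l = smult (1 / ((qq - 1) ^ l * qqfact l)) (\<Prod>i<l. [:inverse qq ^ (m + i), - 1:])"

lemma newton_poly_nonzero: "newton_poly m l \<noteq> 0"
  by (simp add: newton_poly_def)

lemma degree_newton_poly: "degree (newton_poly m l) = l"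
proof -
  have "degree (\<Prod>i<l. [:inverse qq ^ (m + i), - 1:]) = (\<Sum>i<l. degree [:inverse qq ^ (m + i), - 1:])"
    by (intro degree_prod_eq_sum_degree) simp
  then show ?thesis
    by (simp add: newton_poly_def)
qed

lemma qder_poly_newton_poly:
  "poly (qder_poly l) (qq powi (- t - int m)) * (qq powi t) ^ l = poly (newton_poly m l) (qq powi t)"
proof -
  have "(qq powi (- t - int m) * inverse qq ^ i - 1) * qq powi t = inverse qq ^ (m + i) - qq powi t" for i
    by (simp add: left_diff_distrib power_int_diff power_int_minus power_add power_inverse field_simps)
  then have "(\<Prod>i<l. qq powi (- t - int m) * inverse qq ^ i - 1) * (qq powi t) ^ l
      = (\<Prod>i<l. inverse qq ^ (m + i) - qq powi t)"
    using prod.distrib[of "\<lambda>i. qq powi (- t - int m) * inverse qq ^ i - 1" "\<lambda>i. qq powi t" "{..<l}"] by simp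
  then show ?thesis
    by (simp add: poly_qder_poly newton_poly_def poly_prod prod_dividef)
qed

text \<open>Expanding the two polynomials of \<open>window_solvable\<close> in the Newton basis
  gives the multipliers. They come from scalars alone and hence serve every vector.\<close>

lemma relations_solvable:
  assumes "m \<le> k" "h < 2 * m"
  shows "\<exists>\<mu> \<nu>. \<forall>g<2 * m.
    (\<Sum>l<m. \<mu> l * rel1 \<kappa> m k N l m (r + int g) + \<nu> l * rel2 \<kappa> m k N l m (r + int g)) = (if g = h then 1 else 0)"
proof -
  obtain Q1 Q2 :: "qfield poly" where deg: "Q1 = 0 \<or> degree Q1 < m" "Q2 = 0 \<or> degree Q2 < m"
    and Q: "\<And>g w. g < 2 * m \<Longrightarrow> w = qq powi (r + int g) \<Longrightarrow>
       w * poly Q1 w + w powi (- int k) * poly Q2 w = (if g = h then 1 else 0)"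
    using window_solvable[OF assms, of r] unfolding Let_def by blast
  have newton: "\<And>l. l < m \<Longrightarrow> newton_poly m l \<noteq> 0 \<and> degree (newton_poly m l) = l"
    by (simp add: newton_poly_nonzero degree_newton_poly)
  obtain \<mu>' where \<mu>': "Q1 = (\<Sum>l<m. smult (\<mu>' l) (newton_poly m l))"
    using poly_combination_of_degrees[OF newton deg(1)] by blast
  obtain \<nu>' where \<nu>': "Q2 = (\<Sum>l<m. smult (\<nu>' l) (newton_poly m l))"
    using poly_combination_of_degrees[OF newton deg(2)] by blast
  \<comment> \<open>\<open>C\<close> and \<open>C'\<close> collect the parts of the exponents that
    do not involve \<open>t\<close>; they are divided out in \<open>\<mu>\<close> and
    \<open>\<nu>\<close>.\<close>
  define C where "C = qq powi (- N - int k)"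
  define C' where "C' = qq powi (- int k * int m)"
  have C: "C \<noteq> 0" "C' \<noteq> 0"
    by (simp_all add: C_def C'_def)
  define \<mu> where "\<mu> l = \<mu>' l / C ^ (l + 1)" for l
  define \<nu> where "\<nu> l = \<nu>' l / (C' * C ^ l)" for l
  have "(\<Sum>l<m. \<mu> l * rel1 \<kappa> m k N l m (r + int g) + \<nu> l * rel2 \<kappa> m k N l m (r + int g)) = (if g = h then 1 else 0)"
    if g: "g < 2 * m" for g
  proof -
    define t where "t = r + int g"
    define w where "w = qq powi t"
    have Cw: "(qq ^ j) powi (t - N - int k) = C ^ j * w ^ j" for j
    proof -
      have "t - N - int k = - N - int k + t"
        by simp
      then have "qq powi (t - N - int k) = C * w"
        by (simp only: C_def w_def power_int_add qq_nonzero simp_thms)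
      then show ?thesis
        by (metis mult.commute power_int_power power_int_power' power_mult_distrib)
    qed
    have C'w: "(qq ^ k) powi (- t - int m) = C' * w powi (- int k)"
      by (simp add: C'_def w_def power_int_power algebra_simps flip: power_int_add power_int_mult)
    have "\<mu> l * rel1 \<kappa> m k N l m t + \<nu> l * rel2 \<kappa> m k N l m t =
        w * (\<mu>' l * poly (newton_poly m l) w) + w powi (- int k) * (\<nu>' l * poly (newton_poly m l) w)"
      if l: "l < m" for l
    proof -
      define P where "P = poly (qder_poly l) (qq powi (- t - int m))"
      have newton: "poly (newton_poly m l) w = P * w ^ l"
        using qder_poly_newton_poly[of l t m] by (simp add: w_def P_def)
      have "rel1 \<kappa> m k N l m t = P * (C ^ (l + 1) * w ^ (l + 1))"
        "rel2 \<kappa> m k N l m t = P * (C' * w powi (- int k)) * (C ^ l * w ^ l)"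
        unfolding rel1_top[OF l] rel2_top[OF l] Cw C'w P_def by simp_all
      then show ?thesis
        using C by (simp add: \<mu>_def \<nu>_def newton)
    qed
    then have "(\<Sum>l<m. \<mu> l * rel1 \<kappa> m k N l m t + \<nu> l * rel2 \<kappa> m k N l m t) =
        w * poly Q1 w + w powi (- int k) * poly Q2 w"
      by (simp add: \<mu>' \<nu>' poly_sum sum_distrib_left sum.distrib)
    then show ?thesis
      using Q[OF g, of w] by (simp add: w_def t_def)
  qed
  then show ?thesis
    by (intro exI[of _ \<mu>] exI[of _ \<nu>]) simp
qed

section \<open>The relations realised on vectors\<close>

context commuting_current
begin

definition mode_product :: "int \<Rightarrow> nat \<Rightarrow> 'v \<Rightarrow> nat \<Rightarrow> int \<Rightarrow> 'v" where
  "mode_product N M v m' t = x m' (- t - int m') (x (M - m') (- (N - t) - int (M - m')) v)"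

lemma finite_mode_product: "finite {t. mode_product N M v m' t \<noteq> 0}"
proof -
  let ?s = "- N - int m' - int (M - m')"
  have "{t. mode_product N M v m' t \<noteq> 0} \<subseteq>
      (\<lambda>s. - s - int m') ` {s. x m' s (x (M - m') (?s - s) v) \<noteq> 0}"
  proof
    fix t assume t: "t \<in> {t. mode_product N M v m' t \<noteq> 0}"
    have "?s - (- t - int m') = - (N - t) - int (M - m')"
      by simp
    then have "- t - int m' \<in> {s. x m' s (x (M - m') (?s - s) v) \<noteq> 0}"
      using t by (simp only: mode_product_def mem_Collect_eq) simp
    then show "t \<in> (\<lambda>s. - s - int m') ` {s. x m' s (x (M - m') (?s - s) v) \<noteq> 0}"
      by (rule rev_image_eqI) simp
  qed
  then show ?thesis
    by (rule finite_subset) (simp add: finite_support x_bicommutant)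
qed

lemma finite_mode_product_scale: "finite {t. scale (\<kappa> t) (mode_product N M v m' t) \<noteq> 0}"
  by (rule finite_subset[OF _ finite_mode_product[of N M v m']]) auto

text \<open>Mode \<open>t\<close> of \<open>x m'\<close> sits at exponent \<open>-t-m'\<close>.
  Passing from exponents to modes reflects the summation index.\<close>

lemma mult_modes:
  assumes "m' \<le> M"
  shows "ser_mult (dil scale r (x m')) (dil scale r' (x (M - m'))) (- N - int M) v =
    Sum_any (\<lambda>t. scale ((qq ^ r) powi (- t - int m') * (qq ^ r') powi (t - N - int (M - m')))
      (mode_product N M v m' t))"
proof -
  have *: "- N - int M - (- t - int m') = t - N - int (M - m')" "- int m' - t = - t - int m'"
    "- (N - t) - int (M - m') = t - N - int (M - m')" for t
    using assms by (simp_all add: of_nat_diff)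
  show ?thesis
    unfolding dil_mult_coefficient[OF x_bicommutant x_bicommutant] mode_product_def
    by (subst Sum_any_reflect[of _ "- int m'", symmetric]) (simp only: *)
qed

lemma qprod_modes:
  assumes "m \<le> M"
  shows "qprod scale (dil scale r (x m)) (- int l - 1) (dil scale r' (x (M - m))) (- N - int M - int l) v =
    Sum_any (\<lambda>t. scale (poly (qder_poly l) (qq powi (- t - int m)) * (qq ^ r) powi (- t - int m) *
      (qq ^ (l + r')) powi (t - N - int (M - m))) (mode_product N M v m t))"
proof -
  have *: "- N - int M - int l + int l - (- t - int m) = t - N - int (M - m)" "- int m - t = - t - int m"
    "- (N - t) - int (M - m) = t - N - int (M - m)" for t
    using assms by (simp_all add: of_nat_diff)
  have "qprod scale (dil scale r (x m)) (- int l - 1) (dil scale r' (x (M - m))) (- N - int M - int l) v =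
    Sum_any (\<lambda>t. scale (poly (qder_poly l) (qq powi (- t - int m)) * (qq ^ l) powi (t - N - int (M - m)))
      (dil scale r (x m) (- t - int m) (dil scale r' (x (M - m)) (t - N - int (M - m)) v)))"
    unfolding qprod_coefficient[OF dil_bicommutant[OF x_bicommutant] dil_bicommutant[OF x_bicommutant]]
    by (subst Sum_any_reflect[of _ "- int m", symmetric]) (simp only: *)
  then show ?thesis
    unfolding mode_product_def *(3)
    by (simp add: dil_def bicommutant_simps x_bicommutant power_add power_int_mult_distrib mult.assoc
        mult.left_commute mult.commute)
qed

text \<open>Summation over \<open>m'\<close> picks for each \<open>j\<close> the single value
  \<open>\<iota> j\<close>. The index map is left general because the two families use
  \<open>m - 1 - j\<close> and \<open>j\<close>.\<close>

lemma lower_modes: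
  assumes "\<And>j. j \<le> l \<Longrightarrow> \<iota> j < m"
  shows "(\<Sum>m'<m. Sum_any (\<lambda>t. scale (- (\<Sum>j\<le>l. if m' = \<iota> j then \<kappa> j *
        ((qq ^ \<alpha> j) powi (- t - int m') * (qq ^ \<beta> j) powi (t - N - int (m + k - m'))) else 0))
        (mode_product N (m + k) v m' t))) =
    - (\<Sum>j\<le>l. scale (\<kappa> j) (ser_mult (dil scale (\<alpha> j) (x (\<iota> j)))
        (dil scale (\<beta> j) (x (m + k - \<iota> j))) (- N - int (m + k)) v))"
proof -
  let ?c = "\<lambda>j m' t. (qq ^ \<alpha> j) powi (- t - int m') * (qq ^ \<beta> j) powi (t - N - int (m + k - m'))"
  let ?p = "mode_product N (m + k) v"
  have "Sum_any (\<lambda>t. scale (- (\<Sum>j\<le>l. if m' = \<iota> j then \<kappa> j * ?c j m' t else 0)) (?p m' t)) =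
      (\<Sum>j\<le>l. if m' = \<iota> j then - scale (\<kappa> j) (Sum_any (\<lambda>t. scale (?c j (\<iota> j) t) (?p (\<iota> j) t))) else 0)" for m'
  proof -
    have "Sum_any (\<lambda>t. scale (- (\<Sum>j\<le>l. if m' = \<iota> j then \<kappa> j * ?c j m' t else 0)) (?p m' t)) =
        Sum_any (\<lambda>t. \<Sum>j\<le>l. scale (if m' = \<iota> j then - \<kappa> j * ?c j m' t else 0) (?p m' t))"
      unfolding scale_sum_left[symmetric] sum_negf[symmetric]
      by (intro Sum_any.cong arg_cong2[where f = scale] sum.cong refl) simp
    also have "\<dots> = (\<Sum>j\<le>l. Sum_any (\<lambda>t. scale (if m' = \<iota> j then - \<kappa> j * ?c j m' t else 0) (?p m' t)))"
      by (rule Sum_any_sum) (rule finite_mode_product_scale)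
    also have "\<dots> = (\<Sum>j\<le>l. if m' = \<iota> j then - scale (\<kappa> j) (Sum_any (\<lambda>t. scale (?c j (\<iota> j) t) (?p (\<iota> j) t))) else 0)"
    proof (rule sum.cong)
      fix j
      have "- scale (\<kappa> j) (Sum_any (\<lambda>t. scale (?c j (\<iota> j) t) (?p (\<iota> j) t))) =
          Sum_any (\<lambda>t. scale (- \<kappa> j * ?c j (\<iota> j) t) (?p (\<iota> j) t))"
        using scale_Sum_any[OF finite_mode_product_scale, of "- \<kappa> j" "?c j (\<iota> j)" N "m + k" v "\<iota> j"]
        by (simp only: scale_minus_left[of "\<kappa> j" "Sum_any _"] scale_scale)
      then show "Sum_any (\<lambda>t. scale (if m' = \<iota> j then - \<kappa> j * ?c j m' t else 0) (?p m' t)) =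
          (if m' = \<iota> j then - scale (\<kappa> j) (Sum_any (\<lambda>t. scale (?c j (\<iota> j) t) (?p (\<iota> j) t))) else 0)"
        by (cases "m' = \<iota> j") simp_all
    qed simp
    finally show ?thesis .
  qed
  then have "(\<Sum>m'<m. Sum_any (\<lambda>t. scale (- (\<Sum>j\<le>l. if m' = \<iota> j then \<kappa> j * ?c j m' t else 0)) (?p m' t))) =
      (\<Sum>j\<le>l. \<Sum>m'<m. if m' = \<iota> j then - scale (\<kappa> j) (Sum_any (\<lambda>t. scale (?c j (\<iota> j) t) (?p (\<iota> j) t))) else 0)"
    by (simp only: sum.swap[of _ "{..l}"])
  also have "\<dots> = (\<Sum>j\<le>l. - scale (\<kappa> j) (Sum_any (\<lambda>t. scale (?c j (\<iota> j) t) (?p (\<iota> j) t))))"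
    using assms by (intro sum.cong refl) simp
  also have "\<dots> = - (\<Sum>j\<le>l. scale (\<kappa> j) (ser_mult (dil scale (\<alpha> j) (x (\<iota> j)))
        (dil scale (\<beta> j) (x (m + k - \<iota> j))) (- N - int (m + k)) v))"
    unfolding sum_negf
  proof (intro arg_cong[where f = uminus] sum.cong refl)
    fix j assume "j \<in> {..l}"
    then have "\<iota> j \<le> m + k"
      using assms[of j] by simp
    then show "scale (\<kappa> j) (Sum_any (\<lambda>t. scale (?c j (\<iota> j) t) (?p (\<iota> j) t))) =
        scale (\<kappa> j) (ser_mult (dil scale (\<alpha> j) (x (\<iota> j))) (dil scale (\<beta> j) (x (m + k - \<iota> j))) (- N - int (m + k)) v)"
      by (simp only: mult_modes)
  qed
  finally show ?thesis .
qed

text \<open>The row \<open>m' = m\<close> is the left side of the equality applied to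
  \<open>v\<close>, and the lower rows are minus its right side. This carries the scalar
  coefficients over to actual vectors.\<close>

lemma relation1:
  assumes "l < m"
  shows "(\<Sum>m'\<le>m. Sum_any (\<lambda>t. scale (rel1 (\<lambda>l j. coeff (qder_poly l) (l - j)) m k N l m' t)
    (mode_product N (m + k) v m' t))) = 0"
proof -
  let ?\<kappa> = "\<lambda>l j. coeff (qder_poly l) (l - j)"
  have idx: "m + k - (m - 1 - j) = k + 1 + j" if "j \<le> l" for j
    using that assms by simp
  have "Sum_any (\<lambda>t. scale (rel1 ?\<kappa> m k N l m t) (mode_product N (m + k) v m t)) =
      qprod scale (x m) (- int l - 1) (dil scale 1 (x k)) (- N - int (m + k) - int l) v"
    unfolding rel1_top[OF assms] using qprod_modes[of m "m + k" 0 l 1 N v] by (simp add: dil_0)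
  also have "\<dots> = (\<Sum>j\<le>l. scale (?\<kappa> l j) (ser_mult (dil scale (l + 1) (x (m - 1 - j)))
      (dil scale (l - j) (x (m + k - (m - 1 - j)))) (- N - int (m + k)) v))"
    unfolding qprod_x_left[OF assms] zshift_def by (intro sum.cong refl) (simp only: idx atMost_iff diff_add_cancel)
  moreover have "(\<Sum>m'<m. Sum_any (\<lambda>t. scale (rel1 ?\<kappa> m k N l m' t) (mode_product N (m + k) v m' t))) =
      - (\<Sum>j\<le>l. scale (?\<kappa> l j) (ser_mult (dil scale (l + 1) (x (m - 1 - j)))
      (dil scale (l - j) (x (m + k - (m - 1 - j)))) (- N - int (m + k)) v))"
    using lower_modes[of l "\<lambda>j. m - 1 - j" m "?\<kappa> l" "\<lambda>j. l + 1" "\<lambda>j. l - j" N k v] assms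
    by (simp add: rel1_lower)
  ultimately show ?thesis
    by (simp add: lessThan_Suc_atMost[symmetric])
qed

lemma relation2:
  assumes "l < m"
  shows "(\<Sum>m'\<le>m. Sum_any (\<lambda>t. scale (rel2 (\<lambda>l j. coeff (qder_poly l) (l - j)) m k N l m' t)
    (mode_product N (m + k) v m' t))) = 0"
proof -
  let ?\<kappa> = "\<lambda>l j. coeff (qder_poly l) (l - j)"
  have "Sum_any (\<lambda>t. scale (rel2 ?\<kappa> m k N l m t) (mode_product N (m + k) v m t)) =
      qprod scale (dil scale k (x m)) (- int l - 1) (x k) (- N - int (m + k) - int l) v"
    unfolding rel2_top[OF assms] using qprod_modes[of m "m + k" k l 0 N v] by (simp add: dil_0)
  also have "\<dots> = (\<Sum>j\<le>l. scale (?\<kappa> l j) (ser_mult (dil scale (k + l - j) (x j))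
      (dil scale l (x (m + k - j))) (- N - int (m + k)) v))"
    unfolding qprod_x_right[OF assms] zshift_def by (intro sum.cong refl) simp
  moreover have "(\<Sum>m'<m. Sum_any (\<lambda>t. scale (rel2 ?\<kappa> m k N l m' t) (mode_product N (m + k) v m' t))) =
      - (\<Sum>j\<le>l. scale (?\<kappa> l j) (ser_mult (dil scale (k + l - j) (x j))
      (dil scale l (x (m + k - j))) (- N - int (m + k)) v))"
    using lower_modes[of l "\<lambda>j. j" m "?\<kappa> l" "\<lambda>j. k + l - j" "\<lambda>j. l" N k v] assms
    by (simp add: rel2_lower)
  ultimately show ?thesis
    by (simp add: lessThan_Suc_atMost[symmetric])
qed

lemma combined_relation:
  fixes \<mu> \<nu> :: "nat \<Rightarrow> qfield" and m k :: nat and N :: int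
  defines "\<kappa> \<equiv> \<lambda>l j. coeff (qder_poly l) (l - j)"
  defines "\<rho> \<equiv> \<lambda>m' t. \<Sum>l<m. \<mu> l * rel1 \<kappa> m k N l m' t + \<nu> l * rel2 \<kappa> m k N l m' t"
  shows "(\<Sum>m'\<le>m. Sum_any (\<lambda>t. scale (\<rho> m' t) (mode_product N (m + k) v m' t))) = 0"
proof -
  let ?p = "mode_product N (m + k) v"
  have "Sum_any (\<lambda>t. scale (\<rho> m' t) (?p m' t)) = (\<Sum>l<m.
      scale (\<mu> l) (Sum_any (\<lambda>t. scale (rel1 \<kappa> m k N l m' t) (?p m' t))) +
      scale (\<nu> l) (Sum_any (\<lambda>t. scale (rel2 \<kappa> m k N l m' t) (?p m' t))))" for m'
  proof -
    have "Sum_any (\<lambda>t. scale (\<rho> m' t) (?p m' t)) =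
        (\<Sum>l<m. Sum_any (\<lambda>t. scale (\<mu> l * rel1 \<kappa> m k N l m' t + \<nu> l * rel2 \<kappa> m k N l m' t) (?p m' t)))"
      unfolding \<rho>_def scale_sum_left by (rule Sum_any_sum) (rule finite_mode_product_scale)
    also have "\<dots> = (\<Sum>l<m. scale (\<mu> l) (Sum_any (\<lambda>t. scale (rel1 \<kappa> m k N l m' t) (?p m' t))) +
      scale (\<nu> l) (Sum_any (\<lambda>t. scale (rel2 \<kappa> m k N l m' t) (?p m' t))))"
      unfolding scale_left_distrib Sum_any.distrib[OF finite_mode_product_scale finite_mode_product_scale]
        scale_Sum_any[OF finite_mode_product_scale] scale_scale ..
    finally show ?thesis .
  qed
  then have "(\<Sum>m'\<le>m. Sum_any (\<lambda>t. scale (\<rho> m' t) (?p m' t))) = (\<Sum>l<m.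
      scale (\<mu> l) (\<Sum>m'\<le>m. Sum_any (\<lambda>t. scale (rel1 \<kappa> m k N l m' t) (?p m' t))) +
      scale (\<nu> l) (\<Sum>m'\<le>m. Sum_any (\<lambda>t. scale (rel2 \<kappa> m k N l m' t) (?p m' t))))"
    by (simp only: sum.swap[of _ "{..<m}"] sum.distrib scale_sum_right)
  also have "\<dots> = 0"
    unfolding \<kappa>_def by (simp add: relation1 relation2)
  finally show ?thesis .
qed

text \<open>Within the window \<open>\<rho> m\<close> is a Kronecker delta, so only the wanted
  vector survives there; everything else moves to the right side.\<close>

lemma mode_product_solution:
  fixes \<rho> :: "nat \<Rightarrow> int \<Rightarrow> qfield" and m :: nat
  assumes rel: "(\<Sum>m'\<le>m. Sum_any (\<lambda>t. scale (\<rho> m' t) (mode_product N M v m' t))) = 0"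
    and window: "\<And>g. g < 2 * m \<Longrightarrow> \<rho> m (r + int g) = (if g = h then 1 else 0)"
    and h: "h < 2 * m"
  shows "mode_product N M v m (r + int h) =
    Sum_any (\<lambda>s. if s \<in> {r..r + 2 * int m - 1} then 0 else scale (- \<rho> m s) (mode_product N M v m s))
    + (\<Sum>m'<m. Sum_any (\<lambda>t. scale (- \<rho> m' t) (mode_product N M v m' t)))"
proof -
  let ?p = "mode_product N M v"
  let ?W = "{r..r + 2 * int m - 1}"
  have neg: "Sum_any (\<lambda>t. scale (- \<rho>' t) (?p m' t)) = - Sum_any (\<lambda>t. scale (\<rho>' t) (?p m' t))" for \<rho>' m'
    using scale_Sum_any[OF finite_mode_product_scale, of "- 1" \<rho>' N M v m'] by simp
  have "\<rho> m s = (if s = r + int h then 1 else 0) + (if s \<in> ?W then 0 else \<rho> m s)" for s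
  proof (cases "s \<in> ?W")
    case True
    then show ?thesis
      using window[of "nat (s - r)"] by auto
  next
    case False
    then show ?thesis
      using h by auto
  qed
  then have "scale (\<rho> m s) (?p m s) = scale (if s = r + int h then 1 else 0) (?p m s) +
      scale (if s \<in> ?W then 0 else \<rho> m s) (?p m s)" for s
    by (metis scale_left_distrib)
  then have "Sum_any (\<lambda>s. scale (\<rho> m s) (?p m s)) =
      Sum_any (\<lambda>s. scale (if s = r + int h then 1 else 0) (?p m s)) +
      Sum_any (\<lambda>s. scale (if s \<in> ?W then 0 else \<rho> m s) (?p m s))"
    by (simp only: Sum_any.distrib[OF finite_mode_product_scale finite_mode_product_scale])
  also have "Sum_any (\<lambda>s. scale (if s = r + int h then 1 else 0) (?p m s)) = ?p m (r + int h)"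
  proof -
    have "Sum_any (\<lambda>s. scale (if s = r + int h then 1 else 0) (?p m s)) =
        Sum_any (\<lambda>s. if s = r + int h then ?p m s else 0)"
      by (rule Sum_any.cong) simp
    then show ?thesis
      by simp
  qed
  also have "Sum_any (\<lambda>s. scale (if s \<in> ?W then 0 else \<rho> m s) (?p m s)) =
      - Sum_any (\<lambda>s. if s \<in> ?W then 0 else scale (- \<rho> m s) (?p m s))"
  proof -
    have "Sum_any (\<lambda>s. if s \<in> ?W then 0 else scale (- \<rho> m s) (?p m s)) =
        Sum_any (\<lambda>s. scale (- (if s \<in> ?W then 0 else \<rho> m s)) (?p m s))"
      by (rule Sum_any.cong) simp
    then show ?thesis
      unfolding neg by simp
  qed
  finally have top: "Sum_any (\<lambda>s. scale (\<rho> m s) (?p m s)) = ?p m (r + int h) +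
      - Sum_any (\<lambda>s. if s \<in> ?W then 0 else scale (- \<rho> m s) (?p m s))" .
  have solve: "u = w + - z" if "z + (u + - w) = 0" for u w z :: 'v
    using that by (simp add: algebra_simps eq_diff_eq)
  show ?thesis
    unfolding neg sum_negf
    by (rule solve) (use rel top in \<open>simp only: lessThan_Suc_atMost[symmetric] sum.lessThan_Suc\<close>)
qed

end

section \<open>The proposition\<close>

lemma xbar_commuting_current:
  assumes "integrable_highest_weight_module scale n c e f K qd xp xm a" "i \<in> {1..n}"
  shows "commuting_current scale (xbar1 scale c (xp i) (a i)) (xbar scale c (xp i) (a i))"
proof -
  interpret integrable_highest_weight_module scale n c e f K qd xp xm a
    by fact
  show ?thesis
    using xbar1_in_Eser[OF assms(2)] xbar1_commute[OF assms(2)]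
    by (intro commuting_current.intro commuting_current_axioms.intro vector_space_axioms) simp_all
qed

theorem proposition5p4:
  fixes scale :: "qfield \<Rightarrow> 'v::ab_group_add \<Rightarrow> 'v"
    and e f K :: "nat \<Rightarrow> 'v \<Rightarrow> 'v" and qd :: "'v \<Rightarrow> 'v"
    and xp xm a :: "nat \<Rightarrow> int \<Rightarrow> 'v \<Rightarrow> 'v"
    and n c i m k :: nat
  assumes L: "integrable_highest_weight_module scale n c e f K qd xp xm a"
    and c: "c > 0" and i: "i \<in> {1..n}"
    and mk: "1 \<le> m" "m \<le> k" "k \<le> c"
  defines "x \<equiv> xbar scale c (xp i) (a i)"
    and "y \<equiv> xmode scale c (xp i) (a i)"
    and "V \<equiv> qva_generated scale (Sgen scale c (xp i) (a i))"
  shows "\<exists>cc dd :: nat \<Rightarrow> nat \<Rightarrow> qfield.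
    (\<forall>l<m. \<forall>j\<le>l. cc l j \<in> Cq \<and> dd l j \<in> Cq) \<and>
    compatible (x m) (dil scale 1 (x k)) \<and>
    (\<forall>l<m.
       qprod scale (x m) (- int l - 1) (dil scale 1 (x k)) =
         zshift l (\<lambda>p v. \<Sum>j\<le>l. scale (cc l j)
           (ser_mult (dil scale (l + 1) (x (m - 1 - j))) (dil scale (l - j) (x (k + 1 + j))) p v)) \<and>
       qprod scale (x m) (- int l - 1) (dil scale 1 (x k)) \<in> V) \<and>
    compatible (dil scale k (x m)) (x k) \<and>
    (\<forall>l<m.
       qprod scale (dil scale k (x m)) (- int l - 1) (x k) =
         zshift l (\<lambda>p v. \<Sum>j\<le>l. scale (dd l j)
           (ser_mult (dil scale (k + l - j) (x j)) (dil scale l (x (m + k - j))) p v)) \<and>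
       qprod scale (dil scale k (x m)) (- int l - 1) (x k) \<in> V) \<and>
    (\<forall>(r :: int) (N :: int). \<forall>h<2 * m. \<exists>(\<mu> :: nat \<Rightarrow> qfield) (\<nu> :: nat \<Rightarrow> qfield).
       let \<rho> = (\<lambda>m' t. \<Sum>l<m. \<mu> l * rel1 cc m k N l m' t + \<nu> l * rel2 dd m k N l m' t)
       in (\<forall>g<2 * m. \<rho> m (r + int g) = (if g = h then 1 else 0)) \<and>
          (\<forall>v. (\<forall>m'\<le>m. finite {t. y m' t (y (m + k - m') (N - t) v) \<noteq> 0}) \<and>
               y m (r + int h) (y k (N - (r + int h)) v) =
                 Sum_any (\<lambda>s. if s \<in> {r..r + 2 * int m - 1} then 0
                              else scale (- \<rho> m s) (y m s (y k (N - s) v)))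
                 + (\<Sum>m'<m. Sum_any (\<lambda>t. scale (- \<rho> m' t)
                                             (y m' t (y (m + k - m') (N - t) v))))))"
proof -
  interpret commuting_current scale "xbar1 scale c (xp i) (a i)" x
    unfolding x_def by (rule xbar_commuting_current[OF L i])
  \<comment> \<open>One family of constants serves as witness for both \<open>cc\<close> and
    \<open>dd\<close>, since both products expand the same derivative.\<close>
  define \<kappa> where "\<kappa> l j = coeff (qder_poly l) (l - j)" for l j
  have V: "V = qva_generated scale {dil scale l (xbar1 scale c (xp i) (a i)) |l. True}"
    by (simp add: V_def Sgen_def)
  have modes: "y m' t (y (m + k - m') (N - t) v) = mode_product N (m + k) v m' t" for m' t N v
  proof -
    have "y m' t = x m' (- t - int m')" for m' t
      by (simp add: y_def x_def xmode_def)
    then show ?thesis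
      by (simp only: mode_product_def)
  qed
  have modes_m: "y m t (y k (N - t) v) = mode_product N (m + k) v m t" for t N v
    using modes[of m t N v] by simp
  show ?thesis
  proof (intro exI[of _ \<kappa>] conjI allI impI)
    show "\<kappa> l j \<in> Cq" "\<kappa> l j \<in> Cq" for l j
      by (simp_all add: \<kappa>_def coeff_qder_poly_in_Cq)
    show "compatible (x m) (dil scale 1 (x k))" "compatible (dil scale k (x m)) (x k)"
      by (intro compatible_bicommutant dil_bicommutant x_bicommutant)+
    show "qprod scale (x m) (- int l - 1) (dil scale 1 (x k)) \<in> V"
      "qprod scale (dil scale k (x m)) (- int l - 1) (x k) \<in> V" for l
      unfolding V using qprod_x_generated[of 0 m "- int l - 1" 1 k]
        qprod_x_generated[of k m "- int l - 1" 0 k] by (simp_all add: dil_0)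
    show "qprod scale (x m) (- int l - 1) (dil scale 1 (x k)) =
         zshift l (\<lambda>p v. \<Sum>j\<le>l. scale (\<kappa> l j)
           (ser_mult (dil scale (l + 1) (x (m - 1 - j))) (dil scale (l - j) (x (k + 1 + j))) p v))"
      if "l < m" for l
      unfolding \<kappa>_def by (rule qprod_x_left[OF that])
    show "qprod scale (dil scale k (x m)) (- int l - 1) (x k) =
         zshift l (\<lambda>p v. \<Sum>j\<le>l. scale (\<kappa> l j)
           (ser_mult (dil scale (k + l - j) (x j)) (dil scale l (x (m + k - j))) p v))"
      if "l < m" for l
      unfolding \<kappa>_def by (rule qprod_x_right[OF that])
    fix r N :: int and h :: nat
    assume h: "h < 2 * m"
    \<comment> \<open>The multipliers are fixed before any vector appears, as the order of
      quantifiers demands.\<close>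
    obtain \<mu> \<nu> where sol: "\<And>g. g < 2 * m \<Longrightarrow>
        (\<Sum>l<m. \<mu> l * rel1 \<kappa> m k N l m (r + int g) + \<nu> l * rel2 \<kappa> m k N l m (r + int g)) = (if g = h then 1 else 0)"
      using relations_solvable[OF mk(2) h] by blast
    define \<rho> where "\<rho> = (\<lambda>m' t. \<Sum>l<m. \<mu> l * rel1 \<kappa> m k N l m' t + \<nu> l * rel2 \<kappa> m k N l m' t)"
    have window: "\<rho> m (r + int g) = (if g = h then 1 else 0)" if "g < 2 * m" for g
      unfolding \<rho>_def using sol[OF that] .
    have rel: "(\<Sum>m'\<le>m. Sum_any (\<lambda>t. scale (\<rho> m' t) (mode_product N (m + k) v m' t))) = 0" for v
      unfolding \<rho>_def \<kappa>_def by (rule combined_relation)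
    show "\<exists>\<mu> \<nu>.
       let \<rho> = (\<lambda>m' t. \<Sum>l<m. \<mu> l * rel1 \<kappa> m k N l m' t + \<nu> l * rel2 \<kappa> m k N l m' t)
       in (\<forall>g<2 * m. \<rho> m (r + int g) = (if g = h then 1 else 0)) \<and>
          (\<forall>v. (\<forall>m'\<le>m. finite {t. y m' t (y (m + k - m') (N - t) v) \<noteq> 0}) \<and>
               y m (r + int h) (y k (N - (r + int h)) v) =
                 Sum_any (\<lambda>s. if s \<in> {r..r + 2 * int m - 1} then 0
                              else scale (- \<rho> m s) (y m s (y k (N - s) v)))
                 + (\<Sum>m'<m. Sum_any (\<lambda>t. scale (- \<rho> m' t)
                                             (y m' t (y (m + k - m') (N - t) v)))))"
      unfolding Let_def modes modes_m
      using window finite_mode_product mode_product_solution[OF rel window h]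
      unfolding \<rho>_def by (intro exI[of _ \<mu>] exI[of _ \<nu>]) blast
  qed
qed

end
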